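(* Let $\mathbb F$ be a local field of characteristic $p>0$, let $G$ be a linear algebraic $\mathbb F$-group, and let $g\in G(\mathbb F)$. Let $q$ be any prime number. Suppose that for each $k\in\mathbb N$ there exists $x_k\in G(\mathbb F)$ such that $x_k^{q^k}=g$. Let $H$ be the Zariski-closure of the group generated by $g$. Then: (1) for each $k\in\mathbb N$ there exists $y_k\in H(\mathbb F)$ such that $y_k^{q^k}=g$; (2) if the order of $g$ is finite, then the order of $g$ is co-prime to $q$; (3) if $g$ has $k$-th roots in $G(\mathbb F)$ for all $k\in\mathbb N$ (i.e. for every $k\in\mathbb N$ there is $h\in G(\mathbb F)$ with $h^k=g$), then $g=e$.
   Context: Here $e$ denotes the identity element of $G$. $H$ is an algebraic subgroup of $G$ defined over $\mathbb F$, and $H(\mathbb F)$ is its group of $\mathbb F$-points. *)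

theory Defs
  imports
    "HOL-Analysis.Abstract_Metric_Spaces"
    "HOL-Algebra.Multiplicative_Group"
    "HOL-Algebra.Generated_Groups"
    "HOL-Computational_Algebra.Computational_Algebra"
    "HOL-Library.Poly_Mapping"
    "Jordan_Normal_Form.Matrix"
begin

subsection \<open>Local fields\<close>

definition absolute_value :: "('f::field \<Rightarrow> real) \<Rightarrow> bool" where
  "absolute_value v \<longleftrightarrow>
     (\<forall>x. 0 \<le> v x) \<and> (\<forall>x. v x = 0 \<longleftrightarrow> x = 0) \<and>
     (\<forall>x y. v (x * y) = v x * v y) \<and> (\<forall>x y. v (x + y) \<le> v x + v y)"

text \<open>A local field is a field that is locally compact in the topology of a nontrivial
  absolute value. Nontriviality says that this topology is not discrete.\<close>

definition local_field :: "'f::field itself \<Rightarrow> bool" where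
  "local_field _ \<longleftrightarrow>
     (\<exists>v :: 'f \<Rightarrow> real. absolute_value v \<and> (\<exists>x. x \<noteq> 0 \<and> v x \<noteq> 1) \<and>
        locally_compact_space (Metric_space.mtopology UNIV (\<lambda>x y. v (x - y))))"


subsection \<open>The group \<open>GL\<^sub>n\<close>\<close>

definition GL :: "nat \<Rightarrow> ('a::field mat) monoid" where
  "GL n = units_of (ring_mat TYPE('a) n ())"

lemma group_GL: "group (GL n)"
proof -
  interpret semiring "ring_mat TYPE('a) n ()" by (rule semiring_mat)
  show ?thesis unfolding GL_def by (rule units_group)
qed


subsection \<open>Polynomials in the matrix entries\<close>

text \<open>The variable \<open>(i, j)\<close> stands for the matrix entry in row \<open>i\<close>, column \<open>j\<close>
  (counted from 0), and a monomial is its finitely supported exponent function.\<close>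

type_synonym 'a matrix_poly = "((nat \<times> nat) \<Rightarrow>\<^sub>0 nat) \<Rightarrow>\<^sub>0 'a"

definition matrix_polys :: "nat \<Rightarrow> ('a::field matrix_poly) set" where
  "matrix_polys n = {f. \<forall>m \<in> Poly_Mapping.keys f. Poly_Mapping.keys m \<subseteq> {..<n} \<times> {..<n}}"

definition eval_at :: "'a::field matrix_poly \<Rightarrow> 'a mat \<Rightarrow> 'a" where
  "eval_at f A =
     (\<Sum>m \<in> Poly_Mapping.keys f. Poly_Mapping.lookup f m *
        (\<Prod>ij \<in> Poly_Mapping.keys m. (A $$ ij) ^ Poly_Mapping.lookup m ij))"


subsection \<open>Zariski topology and rationality\<close>

text \<open>\<open>GL\<^sub>n\<close> carries the topology induced from the affine space of all matrices.
  Allowing \<open>1 / det\<close> as an additional coordinate gives the same closed sets,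
  since a power of the nowhere vanishing determinant clears denominators.\<close>

definition zariski_closed :: "nat \<Rightarrow> ('k::field mat) set \<Rightarrow> bool" where
  "zariski_closed n Z \<longleftrightarrow>
     (\<exists>P \<subseteq> matrix_polys n. Z = {A \<in> carrier (GL n). \<forall>f \<in> P. eval_at f A = 0})"

definition zariski_closure :: "nat \<Rightarrow> ('k::field mat) set \<Rightarrow> ('k mat) set" where
  "zariski_closure n S = \<Inter> {Z. zariski_closed n Z \<and> S \<subseteq> Z}"

definition vanishing_ideal :: "nat \<Rightarrow> ('k::field mat) set \<Rightarrow> ('k matrix_poly) set" where
  "vanishing_ideal n Z = {f \<in> matrix_polys n. \<forall>A \<in> Z. eval_at f A = 0}"

text \<open>\<open>Z\<close> is defined over the subfield \<open>\<iota>(F)\<close> if its ideal (not merely the set \<open>Z\<close>) is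
  generated by polynomials with coefficients in that subfield. For subsets of \<open>GL\<^sub>n\<close> it does
  not matter whether the ideal is taken in the coordinate ring of the matrices or in that of
  \<open>GL\<^sub>n\<close>: \<open>det\<close> has coefficients in \<open>\<iota>(F)\<close> and vanishes nowhere on \<open>Z\<close>.\<close>

definition defined_over ::
    "('f::field \<Rightarrow> 'k::field) \<Rightarrow> nat \<Rightarrow> ('k mat) set \<Rightarrow> bool" where
  "defined_over \<iota> n Z \<longleftrightarrow>
     (\<forall>f \<in> vanishing_ideal n Z.
        \<exists>(S :: 'f matrix_poly set) c. finite S \<and> S \<subseteq> matrix_polys n \<and>
          (\<forall>s \<in> S. Poly_Mapping.map \<iota> s \<in> vanishing_ideal n Z \<and> c s \<in> matrix_polys n) \<and>
          f = (\<Sum>s \<in> S. c s * Poly_Mapping.map \<iota> s))"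

text \<open>A linear algebraic group over \<open>F\<close> is given by its points in an algebraically closed
  extension \<open>\<iota> : F \<rightarrow> K\<close>, as a closed subgroup of some \<open>GL\<^sub>n(K)\<close> that is defined over \<open>F\<close>.\<close>

definition linear_algebraic_group ::
    "('f::field \<Rightarrow> 'k::alg_closed_field) \<Rightarrow> nat \<Rightarrow> ('k mat) set \<Rightarrow> bool" where
  "linear_algebraic_group \<iota> n G \<longleftrightarrow>
     subgroup G (GL n) \<and> zariski_closed n G \<and> defined_over \<iota> n G"

definition rational_points ::
    "('f::field \<Rightarrow> 'k::field) \<Rightarrow> nat \<Rightarrow> ('k mat) set \<Rightarrow> ('f mat) set" where
  "rational_points \<iota> n Z = {A \<in> carrier (GL n). map_mat \<iota> A \<in> Z}"

end

theory Submission
  imports Defs "Jordan_Normal_Form.Char_Poly" "HOL-Number_Theory.Residues"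
begin

text \<open>Write \<open>v\<close> for an absolute value of the local field \<open>F\<close> of characteristic \<open>p\<close>, and let
  \<open>x\<^sub>k\<close> be matrices over \<open>F\<close> with \<open>x\<^sub>k^(q^k) = g\<close>.

  Eigenvalues of the \<open>x\<^sub>k\<close> lie in the large field \<open>K\<close> and have degree at most \<open>n\<close> over \<open>F\<close>.
  The proof measures them with a valuation ring \<open>V\<close> of \<open>K\<close> that lies over the unit ball of \<open>F\<close>
  (\<open>valuation_extension_exists\<close>). An element of degree at most \<open>n\<close> has its \<open>n!\<close>-th
  power in \<open>F\<close> up to units of \<open>V\<close>, and the values of \<open>v\<close> are discrete. Hence an element
  with \<open>q^k\<close>-th roots of bounded degree for all \<open>k\<close> is a unit
  (\<open>val_unit_if_infinitely_divisible\<close>), and in particular all eigenvalues of \<open>g\<close> and of the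
  \<open>x\<^sub>k\<close> are units. Since the residue field of \<open>F\<close> is finite, some exponent that depends only on
  \<open>n\<close> and \<open>F\<close> brings all these units to \<open>1\<close> modulo the maximal ideal (\<open>residue_exponent\<close>). Write this
  exponent as \<open>q^a M\<close> with \<open>M\<close> prime to \<open>q\<close>; the factor \<open>q^a\<close> can be absorbed by passing from
  \<open>g\<close> to \<open>x\<^sub>a\<close>.

  If \<open>q = p\<close>, then the eigenvalues of \<open>x\<^sub>k^M - 1\<close> lie in the maximal ideal, and their \<open>p^k\<close>-th
  powers are the eigenvalues of \<open>g^M - 1\<close>. An eigenvalue of \<open>g^M - 1\<close> that is not zero
  would again be a unit, so all of them vanish, \<open>x\<^sub>k^M - 1\<close> is nilpotent, and
  \<open>g^M - 1 = (x\<^sub>k^M - 1)^(p^k) = 0\<close> as soon as \<open>p^k \<ge> n\<close> (\<open>finite_order_if_q_eq_CHAR\<close>).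

  If \<open>q \<noteq> p\<close>, then \<open>g^M - 1\<close> has its eigenvalues in the maximal ideal, so its powers tend to
  \<open>0\<close> by Cayley-Hamilton, and \<open>g^(M p^i)\<close> tends to \<open>1\<close> (\<open>powers_tendsto_1\<close>).

  All three claims follow. In both cases a power of \<open>g\<close> with exponent prime to \<open>q\<close>
  is \<open>1\<close> when \<open>g\<close> has finite order. When \<open>g\<close> has all roots, the case of the prime \<open>p\<close>
  shows that its order is finite, and then this order is prime to every prime. Finally, there are exponents
  \<open>e\<^sub>i\<close> with \<open>e\<^sub>i q^k\<close> close to \<open>1\<close> in the sense that \<open>g^(e\<^sub>i q^k)\<close> tends to \<open>g\<close>. The powers of
  \<open>g\<close> are bounded, so a subsequence of \<open>g^(e\<^sub>i)\<close> converges to some \<open>y\<close> with \<open>y^(q^k) = g\<close>.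
  This limit lies in \<open>H\<close> because a polynomial over \<open>K\<close> that vanishes on a sequence of
  matrices over \<open>F\<close> vanishes on its limit (\<open>zariski_closed_limit\<close>).\<close>

section \<open>Polynomials in a square matrix\<close>

definition poly_mat :: "nat \<Rightarrow> 'a::comm_ring_1 poly \<Rightarrow> 'a mat \<Rightarrow> 'a mat" where
  "poly_mat n f A = fold_coeffs (\<lambda>a B. a \<cdot>\<^sub>m 1\<^sub>m n + B * A) f (0\<^sub>m n n)"

context
  fixes A :: "'a::comm_ring_1 mat" and n :: nat
  assumes A: "A \<in> carrier_mat n n"
begin

lemma poly_mat_0: "poly_mat n 0 A = 0\<^sub>m n n"
  by (simp add: poly_mat_def)

lemma poly_mat_pCons: "poly_mat n (pCons a f) A = a \<cdot>\<^sub>m 1\<^sub>m n + poly_mat n f A * A"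
proof (cases "a = 0 \<and> f = 0")
  case True
  then show ?thesis using A by (auto simp: poly_mat_def)
next
  case False
  then show ?thesis by (auto simp: poly_mat_def)
qed

lemma poly_mat_carrier [simp]: "poly_mat n f A \<in> carrier_mat n n"
  by (induction f) (use A in \<open>auto simp: poly_mat_0 poly_mat_pCons\<close>)

lemma poly_mat_dim [simp]: "dim_row (poly_mat n f A) = n" "dim_col (poly_mat n f A) = n"
  using poly_mat_carrier[of f] by (auto simp only: carrier_matD)

lemma poly_mat_index:
  assumes "i < n" "j < n" "degree f < N"
  shows "poly_mat n f A $$ (i, j) = (\<Sum>k<N. coeff f k * (A ^\<^sub>m k) $$ (i, j))"
  using assms
proof (induction f arbitrary: N j)
  case 0
  then show ?case by (simp add: poly_mat_0)
next
  case (pCons a f)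
  then obtain N' where N': "N = Suc N'" by (cases N) auto
  have deg: "f = 0 \<or> degree f < N'"
    using pCons.prems(3) N' by (auto split: if_splits)
  have *: "poly_mat n f A $$ (i, l) = (\<Sum>k<N'. coeff f k * (A ^\<^sub>m k) $$ (i, l))" if "l < n" for l
    using deg pCons.IH[OF \<open>i < n\<close> that, of N'] that \<open>i < n\<close> by (auto simp: poly_mat_0)
  have "(poly_mat n f A * A) $$ (i, j) = (\<Sum>l<n. poly_mat n f A $$ (i, l) * A $$ (l, j))"
    using A pCons.prems by (simp add: scalar_prod_def atLeast0LessThan)
  also have "\<dots> = (\<Sum>k<N'. \<Sum>l<n. coeff f k * ((A ^\<^sub>m k) $$ (i, l) * A $$ (l, j)))"
    by (subst sum.swap) (simp add: * sum_distrib_right mult.assoc)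
  also have "\<dots> = (\<Sum>k<N'. coeff f k * (A ^\<^sub>m Suc k) $$ (i, j))"
    using A pCons.prems
    by (intro sum.cong refl) (simp add: scalar_prod_def atLeast0LessThan sum_distrib_left)
  finally show ?case
    using A pCons.prems unfolding poly_mat_pCons N'
    by (subst sum.lessThan_Suc_shift) simp
qed

lemma poly_mat_add: "poly_mat n (f + g) A = poly_mat n f A + poly_mat n g A"
proof (rule eq_matI)
  fix i j assume "i < dim_row (poly_mat n f A + poly_mat n g A)" "j < dim_col (poly_mat n f A + poly_mat n g A)"
  then have ij: "i < n" "j < n" by auto
  define N where "N = Suc (max (degree f) (degree g))"
  have "degree (f + g) < N" "degree f < N" "degree g < N"
    using degree_add_le_max[of f g] by (auto simp: N_def less_Suc_eq_le)
  then show "poly_mat n (f + g) A $$ (i, j) = (poly_mat n f A + poly_mat n g A) $$ (i, j)"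
    using ij by (simp add: poly_mat_index[of i j _ N] sum.distrib algebra_simps)
qed auto

lemma poly_mat_smult: "poly_mat n (smult c f) A = c \<cdot>\<^sub>m poly_mat n f A"
proof (rule eq_matI)
  fix i j assume "i < dim_row (c \<cdot>\<^sub>m poly_mat n f A)" "j < dim_col (c \<cdot>\<^sub>m poly_mat n f A)"
  then have ij: "i < n" "j < n" by auto
  have "degree (smult c f) < Suc (degree f)" "degree f < Suc (degree f)"
    using degree_smult_le[of c f] by auto
  then show "poly_mat n (smult c f) A $$ (i, j) = (c \<cdot>\<^sub>m poly_mat n f A) $$ (i, j)"
    using ij by (simp add: poly_mat_index[of i j _ "Suc (degree f)"] sum_distrib_left algebra_simps)
qed auto

lemma poly_mat_commute: "A * poly_mat n f A = poly_mat n f A * A"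
proof (induction f)
  case (pCons a f)
  have "A * poly_mat n (pCons a f) A = a \<cdot>\<^sub>m A + A * (poly_mat n f A * A)"
    unfolding poly_mat_pCons using A
    by (subst mult_add_distrib_mat[of _ n n _ n]) (auto simp: mult_smult_distrib[of _ n n _ n])
  also have "A * (poly_mat n f A * A) = poly_mat n f A * A * A"
    by (subst assoc_mult_mat[symmetric, of _ n n _ n _ n]) (use A pCons in auto)
  also have "a \<cdot>\<^sub>m A + \<dots> = poly_mat n (pCons a f) A * A"
    unfolding poly_mat_pCons using A by (subst add_mult_distrib_mat[of _ n n _ _ n]) auto
  finally show ?case .
qed (use A in \<open>auto simp: poly_mat_0\<close>)

lemma poly_mat_mult: "poly_mat n (f * g) A = poly_mat n f A * poly_mat n g A"
proof (induction f)
  case 0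
  show ?case by (simp add: poly_mat_0 left_mult_zero_mat[OF poly_mat_carrier])
next
  case (pCons a f)
  let ?F = "poly_mat n f A" and ?G = "poly_mat n g A"
  have "poly_mat n (pCons a f * g) A = a \<cdot>\<^sub>m ?G + (?F * ?G * A)"
    using A by (auto simp: poly_mat_add poly_mat_smult poly_mat_pCons pCons.IH mult_pCons_left intro!: eq_matI)
  also have "?F * ?G * A = ?F * A * ?G"
    by (simp add: assoc_mult_mat[of _ n n _ n _ n] A poly_mat_commute)
  also have "a \<cdot>\<^sub>m ?G + \<dots> = poly_mat n (pCons a f) A * ?G"
    unfolding poly_mat_pCons using A by (subst add_mult_distrib_mat[of _ n n _ _ n]) auto
  finally show ?case .
qed

lemma poly_mat_const: "poly_mat n [:c:] A = c \<cdot>\<^sub>m 1\<^sub>m n"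
  using A by (simp add: poly_mat_pCons poly_mat_0)

lemma poly_mat_linear: "poly_mat n [:c, 1:] A = A + c \<cdot>\<^sub>m 1\<^sub>m n"
  using A by (intro eq_matI) (auto simp: poly_mat_pCons poly_mat_0 algebra_simps)

lemma poly_mat_1: "poly_mat n 1 A = 1\<^sub>m n"
  using poly_mat_const[of 1] by (auto simp: one_pCons)

lemma poly_mat_power: "poly_mat n (f ^ m) A = poly_mat n f A ^\<^sub>m m"
  by (induction m) (auto simp: poly_mat_1 poly_mat_mult power_Suc2 simp del: power_Suc)

lemma poly_mat_monom: "poly_mat n (monom 1 m) A = A ^\<^sub>m m"
proof -
  have "monom 1 m = ([:0, 1:] ^ m :: 'a poly)" by (simp add: monom_altdef)
  moreover have "A + 0 \<cdot>\<^sub>m 1\<^sub>m n = A" using A by auto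
  ultimately show ?thesis by (simp add: poly_mat_power poly_mat_linear)
qed

end

text \<open>The adjugate \<open>M\<close> of \<open>X - A\<close> satisfies \<open>M (X - A) = \<chi> 1\<close>. Its coefficient of \<open>X^k\<close>
  expresses the \<open>k\<close>-th coefficient of \<open>\<chi>\<close> as \<open>M\<^sub>k\<^sub>-\<^sub>1 - M\<^sub>k A\<close>. After multiplication by
  \<open>A^k\<close> on the right the sum over \<open>k\<close> telescopes; the proof does this entry by entry.\<close>
lemma Cayley_Hamilton:
  fixes A :: "'a::comm_ring_1 mat"
  assumes A: "A \<in> carrier_mat n n"
  shows "poly_mat n (char_poly A) A = 0\<^sub>m n n"
proof (rule eq_matI)
  define M where "M = adj_mat (char_poly_matrix A)"
  have M: "M \<in> carrier_mat n n" and M_eq: "M * char_poly_matrix A = char_poly A \<cdot>\<^sub>m 1\<^sub>m n"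
    using adj_mat[of "char_poly_matrix A" n] A by (auto simp: M_def char_poly_def)
  fix i j assume "i < dim_row (0\<^sub>m n n :: 'a mat)" "j < dim_col (0\<^sub>m n n :: 'a mat)"
  then have ij: "i < n" "j < n" by auto
  define D where "D = Suc (Max (insert (degree (char_poly A)) ((\<lambda>s. degree (M $$ (i, s))) ` {..<n})))"
  have D: "degree (char_poly A) < D" "\<And>s. s < n \<Longrightarrow> degree (M $$ (i, s)) < D"
    by (auto simp: D_def less_Suc_eq_le intro!: Max_ge)
  \<comment> \<open>The telescoping summand, the entry of \<open>M\<^sub>k A^(k + 1)\<close>.\<close>
  define T where "T k = (\<Sum>s<n. coeff (M $$ (i, s)) k * (A ^\<^sub>m Suc k) $$ (s, j))" for k
  have entry: "(if i = s then char_poly A else 0) =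
      pCons 0 (M $$ (i, s)) - (\<Sum>l<n. smult (A $$ (l, s)) (M $$ (i, l)))" if s: "s < n" for s
  proof -
    have "(if i = s then char_poly A else 0) = (M * char_poly_matrix A) $$ (i, s)"
      using s ij by (simp add: M_eq)
    also have "\<dots> = (\<Sum>l<n. M $$ (i, l) * ((if l = s then [:0, 1:] else 0) + [:- A $$ (l, s):]))"
      using s ij M A
      by (auto simp: scalar_prod_def atLeast0LessThan char_poly_matrix_def intro!: sum.cong)
    also have "\<dots> = (\<Sum>l<n. if l = s then pCons 0 (M $$ (i, l)) else 0) -
        (\<Sum>l<n. smult (A $$ (l, s)) (M $$ (i, l)))"
      unfolding sum_subtractf[symmetric] by (intro sum.cong refl) (auto simp: algebra_simps)
    finally show ?thesis using s by simp
  qed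
  have step: "coeff (char_poly A) k * (A ^\<^sub>m k) $$ (i, j) = (if k = 0 then 0 else T (k - 1)) - T k" for k
  proof -
    have "coeff (char_poly A) k * (A ^\<^sub>m k) $$ (i, j) =
        (\<Sum>s<n. coeff (if i = s then char_poly A else 0) k * (A ^\<^sub>m k) $$ (s, j))"
      using ij by (simp add: if_distrib[of "\<lambda>f. coeff f k"] if_distrib[of "\<lambda>c. c * _"] cong: if_cong)
    also have "\<dots> = (\<Sum>s<n. (coeff (pCons 0 (M $$ (i, s))) k -
        (\<Sum>l<n. A $$ (l, s) * coeff (M $$ (i, l)) k)) * (A ^\<^sub>m k) $$ (s, j))"
      by (intro sum.cong refl) (simp add: entry coeff_sum)
    also have "\<dots> = (\<Sum>s<n. coeff (pCons 0 (M $$ (i, s))) k * (A ^\<^sub>m k) $$ (s, j)) -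
        (\<Sum>l<n. coeff (M $$ (i, l)) k * (\<Sum>s<n. A $$ (l, s) * (A ^\<^sub>m k) $$ (s, j)))"
      unfolding sum_distrib_left
      by (subst sum.swap) (simp add: left_diff_distrib right_diff_distrib sum_subtractf sum_distrib_left sum_distrib_right mult_ac)
    also have "(\<Sum>s<n. coeff (pCons 0 (M $$ (i, s))) k * (A ^\<^sub>m k) $$ (s, j)) =
        (if k = 0 then 0 else T (k - 1))"
      by (cases k) (auto simp: T_def)
    also have "(\<Sum>l<n. coeff (M $$ (i, l)) k * (\<Sum>s<n. A $$ (l, s) * (A ^\<^sub>m k) $$ (s, j))) = T k"
    proof -
      have "A * A ^\<^sub>m k = A ^\<^sub>m Suc k"
        using poly_mat_commute[OF A, of "monom 1 k"] by (simp add: poly_mat_monom[OF A])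
      then have "(\<Sum>s<n. A $$ (l, s) * (A ^\<^sub>m k) $$ (s, j)) = (A ^\<^sub>m Suc k) $$ (l, j)" if "l < n" for l
        using that ij A unfolding \<open>A * A ^\<^sub>m k = A ^\<^sub>m Suc k\<close>[symmetric]
        by (simp add: scalar_prod_def atLeast0LessThan del: pow_mat.simps)
      then show ?thesis unfolding T_def by (intro sum.cong refl) simp
    qed
    finally show ?thesis .
  qed
  have "(\<Sum>k<m. (if k = 0 then 0 else T (k - 1)) - T k) = (if m = 0 then 0 else - T (m - 1))" for m
    by (induction m) auto
  moreover have "T D = 0"
    unfolding T_def using D(2) by (intro sum.neutral) (simp add: coeff_eq_0)
  ultimately have "(\<Sum>k<Suc D. (if k = 0 then 0 else T (k - 1)) - T k) = 0" by simp
  then show "poly_mat n (char_poly A) A $$ (i, j) = 0\<^sub>m n n $$ (i, j)"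
    using ij D(1) by (simp add: poly_mat_index[OF A, of i j _ "Suc D"] step)
qed (use A in auto)

lemma char_poly_root_iff:
  fixes A :: "'a::field mat"
  assumes A: "A \<in> carrier_mat n n"
  shows "poly (char_poly A) e = 0 \<longleftrightarrow> det (poly_mat n [:- e, 1:] A) = 0"
  using eigenvalue_root_char_poly[OF A] eigenvalue_det[OF A] A
  by (simp add: poly_mat_linear[OF A] char_matrix_def)

text \<open>Both directions come from a factor \<open>X - e\<close> of \<open>f - c\<close>: the determinant is multiplicative, so
  \<open>f(A) - c\<close> is singular exactly if \<open>A - e\<close> is singular for some root \<open>e\<close> of \<open>f - c\<close>.\<close>
lemma spectral_mapping:
  fixes A :: "'a::alg_closed_field mat"
  assumes A: "A \<in> carrier_mat n n" and f: "degree f > 0"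
  shows "poly (char_poly (poly_mat n f A)) c = 0 \<longleftrightarrow> (\<exists>e. poly (char_poly A) e = 0 \<and> poly f e = c)"
proof -
  let ?B = "poly_mat n f A"
  have eq: "poly_mat n [:- c, 1:] ?B = poly_mat n (f - [:c:]) A"
    using poly_mat_add[OF A, of f "[:- c:]"] unfolding diff_conv_add_uminus
    by (simp add: poly_mat_linear[OF poly_mat_carrier[OF A]] poly_mat_const[OF A])
  have "f - [:c:] = f + [:- c:]" by simp
  then have "degree (f - [:c:]) = degree (f + [:- c:])" by (rule arg_cong)
  also have "\<dots> = degree f" using f by (intro degree_add_eq_left) simp
  finally have "degree (f - [:c:]) = degree f" .
  then have f0: "f - [:c:] \<noteq> 0" and degf: "degree (f - [:c:]) > 0"
    using f by auto
  show ?thesis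
  proof
    assume "\<exists>e. poly (char_poly A) e = 0 \<and> poly f e = c"
    then obtain e where e: "poly (char_poly A) e = 0" "poly (f - [:c:]) e = 0" by auto
    then obtain h where "f - [:c:] = [:- e, 1:] * h"
      unfolding poly_eq_0_iff_dvd by (blast elim: dvdE)
    then have "det (poly_mat n [:- c, 1:] ?B) = det (poly_mat n [:- e, 1:] A) * det (poly_mat n h A)"
      by (simp only: eq poly_mat_mult[OF A]) (simp add: det_mult[of _ n] A)
    then show "poly (char_poly ?B) c = 0"
      using e char_poly_root_iff[OF A] char_poly_root_iff[OF poly_mat_carrier[OF A]] by simp
  next
    assume *: "poly (char_poly ?B) c = 0"
    obtain R where R: "f - [:c:] = smult (lead_coeff (f - [:c:])) (\<Prod>x\<in>#R. [:- x, 1:])"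
      using alg_closed_imp_factorization[OF f0] by blast
    have det_R: "det (poly_mat n (\<Prod>x\<in>#R. [:- x, 1:]) A) = (\<Prod>x\<in>#R. det (poly_mat n [:- x, 1:] A))" for R
      by (induction R) (simp_all add: poly_mat_1[OF A] poly_mat_mult[OF A] det_mult[of _ n] A del: mult_pCons_left)
    have zero: "0 = lead_coeff (f - [:c:]) ^ n * (\<Prod>x\<in>#R. det (poly_mat n [:- x, 1:] A))"
    proof -
      have "poly_mat n [:- c, 1:] ?B =
          lead_coeff (f - [:c:]) \<cdot>\<^sub>m poly_mat n (\<Prod>x\<in>#R. [:- x, 1:]) A"
        by (simp only: eq R[symmetric] poly_mat_smult[OF A, symmetric])
      then show ?thesis
        using * unfolding char_poly_root_iff[OF poly_mat_carrier[OF A]]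
        by (simp only: det_smult det_R poly_mat_dim[OF A])
    qed
    have "lead_coeff (f - [:c:]) ^ n \<noteq> 0"
      using f0 by (intro power_not_zero) (simp only: leading_coeff_0_iff not_False_eq_True)
    then have "(\<Prod>x\<in>#R. det (poly_mat n [:- x, 1:] A)) = 0"
      using mult_eq_0_iff[THEN iffD1, OF zero[symmetric]] by blast
    then obtain x where x: "x \<in># R" "det (poly_mat n [:- x, 1:] A) = 0"
      by (auto simp: prod_mset_zero_iff)
    then have "poly (\<Prod>x\<in>#R. [:- x, 1:]) x = 0"
      by (auto simp: poly_prod_mset prod_mset_zero_iff)
    then have "poly (f - [:c:]) x = 0" by (subst R) simp
    then show "\<exists>e. poly (char_poly A) e = 0 \<and> poly f e = c"
      using x char_poly_root_iff[OF A] by auto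
  qed
qed

section \<open>Absolute values of local fields of positive characteristic\<close>

text \<open>The properties of a local field of positive characteristic that the proof uses. Local
  compactness enters as the existence of convergent subsequences of bounded sequences.\<close>
locale local_abs =
  fixes v :: "'f::field \<Rightarrow> real"
  assumes abs_nonneg [simp]: "0 \<le> v x"
    and abs_eq_0 [simp]: "v x = 0 \<longleftrightarrow> x = 0"
    and abs_mult: "v (x * y) = v x * v y"
    and ultrametric: "v (x + y) \<le> max (v x) (v y)"
    and nontrivial: "\<exists>x. x \<noteq> 0 \<and> v x < 1"
    and Bolzano_Weierstrass:
      "(\<And>i::nat. v (c i) \<le> B) \<Longrightarrow> \<exists>l r. strict_mono r \<and> (\<lambda>i. v (c (r i) - l)) \<longlonglongrightarrow> 0"

text \<open>For \<open>P = p^k\<close> the Frobenius map gives \<open>v(x + y)^P \<le> v(x)^P + v(y)^P \<le> 2 max^P\<close>. If the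
  quotient \<open>t = v(x + y) / max\<close> exceeded \<open>1\<close>, its powers could not stay below \<open>2\<close>.\<close>
lemma ultrametric_if_CHAR_pos:
  fixes v :: "'f::field \<Rightarrow> real"
  assumes v: "absolute_value v" and char: "CHAR('f) > 0"
  shows "v (x + y) \<le> max (v x) (v y)"
proof (rule ccontr)
  define m where "m = max (v x) (v y)"
  have nonneg: "0 \<le> v x" and mult: "v (x * y) = v x * v y" and add: "v (x + y) \<le> v x + v y"
    and zero: "v x = 0 \<longleftrightarrow> x = 0" for x y
    using v by (auto simp: absolute_value_def)
  have power: "v (x ^ k) = v x ^ k" if "k > 0" for x k
    using that by (induction k rule: nat_induct_non_zero) (simp_all add: mult)
  assume "\<not> v (x + y) \<le> max (v x) (v y)"
  then have less: "m < v (x + y)" by (simp add: m_def not_le)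
  have m: "v x \<le> m" "v y \<le> m" "0 \<le> m" by (auto simp: m_def nonneg le_max_iff_disj)
  have "m \<noteq> 0"
  proof
    assume "m = 0"
    then have "v x = 0" "v y = 0" using m nonneg[of x] nonneg[of y] by linarith+
    then have "x = 0" "y = 0" by (simp_all only: zero)
    then show False using less \<open>m = 0\<close> zero[of 0] by simp
  qed
  then have "m > 0" using m by simp
  define t where "t = v (x + y) / m"
  have "t > 1" using less \<open>m > 0\<close> by (simp add: t_def)
  then obtain k where k: "2 < t ^ k" using real_arch_pow[of t 2] by blast
  define P where "P = CHAR('f) ^ k"
  have prime: "prime CHAR('f)" using char by (rule prime_CHAR_semidom)
  have "k < 2 ^ k" by (rule less_exp)
  also have "(2::nat) ^ k \<le> P" unfolding P_def using prime_ge_2_nat[OF prime] by (rule power_mono) simp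
  finally have "k \<le> P" "P > 0" by auto
  have "2 < t ^ P" using k power_increasing[OF \<open>k \<le> P\<close>, of t] \<open>t > 1\<close> by linarith
  moreover have "t ^ P \<le> 2"
  proof -
    have "v (x + y) ^ P = v (x ^ P + y ^ P)"
      using freshmans_dream'[OF prime P_def, of x y] power[OF \<open>P > 0\<close>, of "x + y"] by simp
    also have "\<dots> \<le> v x ^ P + v y ^ P" using add[of "x ^ P" "y ^ P"] by (simp only: power[OF \<open>P > 0\<close>])
    also have "\<dots> \<le> m ^ P + m ^ P" using m nonneg by (intro add_mono power_mono) auto
    finally show ?thesis using \<open>m > 0\<close> by (simp add: t_def power_divide divide_simps)
  qed
  ultimately show False by simp
qed

text \<open>Some compact set contains a small ball around \<open>0\<close>, and multiplication by a
  high power of an element of absolute value below \<open>1\<close> moves any bounded sequence into that ball.\<close>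
lemma local_field_imp_local_abs:
  assumes F: "local_field TYPE('f::field)" and char: "CHAR('f::field) > 0"
  obtains v :: "'f::field \<Rightarrow> real" where "local_abs v"
proof -
  obtain v :: "'f \<Rightarrow> real" and a where v: "absolute_value v" and a: "a \<noteq> 0" "v a \<noteq> 1"
    and lc: "locally_compact_space (Metric_space.mtopology UNIV (\<lambda>x y. v (x - y)))"
    using F unfolding local_field_def by blast
  have nonneg: "0 \<le> v x" and mult: "v (x * y) = v x * v y" and add: "v (x + y) \<le> v x + v y"
    and zero: "v x = 0 \<longleftrightarrow> x = 0" for x y
    using v by (auto simp: absolute_value_def)
  have ultra: "v (x + y) \<le> max (v x) (v y)" for x y
    using v char by (rule ultrametric_if_CHAR_pos)
  have one: "v 1 = 1" using mult[of 1 1] zero[of 1] by simp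
  have "v (-1) * v (-1) = 1" using mult[of "-1" "-1"] one by simp
  then have "v (-1) = 1" using nonneg[of "-1"] by (simp add: square_eq_1_iff)
  then have minus: "v (- x) = v x" for x using mult[of "-1" x] by simp
  have inv: "v (inverse x) = inverse (v x)" for x
    using mult[of x "inverse x"] one zero[of x] by (cases "x = 0") (auto simp: field_simps)
  have power: "v (x ^ k) = v x ^ k" for x k by (induction k) (auto simp: mult one)
  obtain b where b: "b \<noteq> 0" "v b < 1"
  proof (cases "v a < 1")
    case True
    then show ?thesis using a that by blast
  next
    case False
    then have "v (inverse a) < 1" using a by (simp add: inv inverse_less_1_iff)
    then show ?thesis using a by (intro that[of "inverse a"]) auto
  qed
  interpret M: Metric_space UNIV "\<lambda>x y. v (x - y)"
  proof
    show "v (x - y) = v (y - x)" for x y using minus[of "x - y"] by simp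
    show "v (x - z) \<le> v (x - y) + v (y - z)" for x y z using add[of "x - y" "y - z"] by simp
  qed (auto simp: nonneg zero)
  obtain U K where U: "openin M.mtopology U" "0 \<in> U" "U \<subseteq> K" and K: "compactin M.mtopology K"
  proof -
    have "\<exists>U K. openin M.mtopology U \<and> compactin M.mtopology K \<and> 0 \<in> U \<and> U \<subseteq> K"
      using lc unfolding locally_compact_space_def by simp
    then show ?thesis using that by blast
  qed
  obtain e where e: "e > 0" "M.mball 0 e \<subseteq> U" using U M.openin_mtopology by blast
  have BW: "\<exists>l r. strict_mono r \<and> (\<lambda>i. v (c (r i) - l)) \<longlonglongrightarrow> 0" if c: "\<And>i::nat. v (c i) \<le> B" for c B
  proof -
    have "(\<lambda>k. v b ^ k) \<longlonglongrightarrow> 0" using b nonneg by (intro LIMSEQ_power_zero) auto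
    then have "(\<lambda>k. v b ^ k * B) \<longlonglongrightarrow> 0" by (rule tendsto_mult_left_zero)
    then have "eventually (\<lambda>k. v b ^ k * B < e) sequentially" using e by (intro order_tendstoD)
    then obtain k where k: "v b ^ k * B < e" by (auto simp: eventually_sequentially)
    define w where "w = b ^ k"
    have "w \<noteq> 0" using b by (simp add: w_def)
    then have vw: "v w > 0" using nonneg[of w] zero[of w] by linarith
    have "v (w * c i) < e" for i
    proof -
      have "v (w * c i) \<le> v w * B" using c[of i] vw by (simp add: mult)
      then show ?thesis using k by (simp add: w_def power)
    qed
    then have "w * c i \<in> M.mball 0 e" for i by (simp add: minus)
    then have "range (\<lambda>i. w * c i) \<subseteq> K" using e(2) U(3) by blast
    then obtain l r where lr: "strict_mono r" "limitin M.mtopology ((\<lambda>i. w * c i) \<circ> r) l sequentially"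
      using K unfolding M.compactin_sequentially by blast
    then have "(\<lambda>i. v (w * c (r i) - l)) \<longlonglongrightarrow> 0"
      by (simp add: M.limitin_metric_dist_null comp_def)
    then have "(\<lambda>i. v (inverse w) * v (w * c (r i) - l)) \<longlonglongrightarrow> 0" by (rule tendsto_mult_right_zero)
    moreover have "v (inverse w) * v (w * c (r i) - l) = v (c (r i) - inverse w * l)" for i
    proof -
      have "inverse w * (w * c (r i) - l) = c (r i) - inverse w * l"
        using \<open>w \<noteq> 0\<close> by (simp add: right_diff_distrib)
      then show ?thesis by (simp only: mult[symmetric])
    qed
    ultimately show ?thesis using lr by auto
  qed
  have "local_abs v"
  proof
    show "\<exists>x. x \<noteq> 0 \<and> v x < 1" using b by blast
  qed (fact nonneg zero mult ultra BW)+
  then show ?thesis by (rule that)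
qed

context local_abs
begin

lemma abs_0 [simp]: "v 0 = 0"
  by simp

lemma abs_pos_iff [simp]: "0 < v x \<longleftrightarrow> x \<noteq> 0"
  using abs_nonneg[of x] abs_eq_0[of x] by linarith

lemma abs_1 [simp]: "v 1 = 1"
  using abs_mult[of 1 1] by simp

lemma abs_minus [simp]: "v (- x) = v x"
proof -
  have "v (-1) * v (-1) = 1" using abs_mult[of "-1" "-1"] by simp
  then have "v (-1) = 1" using abs_nonneg[of "-1"] by (simp add: square_eq_1_iff)
  then show ?thesis using abs_mult[of "-1" x] by simp
qed

lemma abs_minus_commute: "v (x - y) = v (y - x)"
  using abs_minus[of "x - y"] by simp

lemma abs_inverse: "v (inverse x) = inverse (v x)"
  using abs_mult[of x "inverse x"] by (cases "x = 0") (auto simp: field_simps)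

lemma abs_divide: "v (x / y) = v x / v y"
  by (simp add: divide_inverse abs_mult abs_inverse)

lemma abs_power: "v (x ^ k) = v x ^ k"
  by (induction k) (auto simp: abs_mult)

lemma ultrametric_le: "v x \<le> B \<Longrightarrow> v y \<le> B \<Longrightarrow> v (x + y) \<le> B"
  using ultrametric[of x y] by simp

lemma ultrametric_diff_le: "v x \<le> B \<Longrightarrow> v y \<le> B \<Longrightarrow> v (x - y) \<le> B"
  using ultrametric_le[of x B "- y"] by simp

lemma ultrametric_sum_le: "(\<And>i. i \<in> I \<Longrightarrow> v (f i) \<le> B) \<Longrightarrow> 0 \<le> B \<Longrightarrow> v (\<Sum>i\<in>I. f i) \<le> B"
  by (induction I rule: infinite_finite_induct) (auto intro: ultrametric_le)

lemma abs_eq_if_close: "v (x - y) < v y \<Longrightarrow> v x = v y"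
  using ultrametric[of "x - y" y] ultrametric[of "y - x" x] abs_minus_commute[of x y] by auto

lemma abs_diff_le: "\<bar>v x - v y\<bar> \<le> v (x - y)"
proof -
  have "max a b \<le> a + b" if "0 \<le> a" "0 \<le> b" for a b :: real using that by simp
  then have "v (a + b) \<le> v a + v b" for a b
    using ultrametric[of a b] by (meson abs_nonneg order_trans)
  from this[of "x - y" y] this[of "y - x" x] show ?thesis
    using abs_minus_commute[of x y] by simp
qed

text \<open>Convergence in the metric of \<open>v\<close>; the field carries no topology as a type.\<close>
definition conv_to :: "(nat \<Rightarrow> 'f) \<Rightarrow> 'f \<Rightarrow> bool" where
  "conv_to c l \<longleftrightarrow> (\<lambda>i. v (c i - l)) \<longlonglongrightarrow> 0"

lemma conv_to_const: "conv_to (\<lambda>i. l) l"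
  by (simp add: conv_to_def)

lemma conv_to_add:
  assumes "conv_to c l" "conv_to d m"
  shows "conv_to (\<lambda>i. c i + d i) (l + m)"
  unfolding conv_to_def
proof (rule tendsto_sandwich[OF _ _ tendsto_const])
  show "(\<lambda>i. v (c i - l) + v (d i - m)) \<longlonglongrightarrow> 0"
    using tendsto_add[OF assms[unfolded conv_to_def]] by simp
  show "\<forall>\<^sub>F i in sequentially. v (c i + d i - (l + m)) \<le> v (c i - l) + v (d i - m)"
  proof (intro always_eventually allI)
    fix i
    have "v (c i + d i - (l + m)) \<le> max (v (c i - l)) (v (d i - m))"
      using ultrametric[of "c i - l" "d i - m"] by (simp add: algebra_simps)
    then show "v (c i + d i - (l + m)) \<le> v (c i - l) + v (d i - m)"
      using abs_nonneg[of "c i - l"] abs_nonneg[of "d i - m"] by linarith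
  qed
qed auto

lemma conv_to_mult:
  assumes "conv_to c l" "conv_to d m"
  shows "conv_to (\<lambda>i. c i * d i) (l * m)"
  unfolding conv_to_def
proof (rule tendsto_sandwich[OF _ _ tendsto_const])
  let ?B = "\<lambda>i. v (c i - l) * v (d i - m) + v l * v (d i - m) + v (c i - l) * v m"
  have "?B \<longlonglongrightarrow> 0 * 0 + v l * 0 + 0 * v m"
    by (intro tendsto_intros assms[unfolded conv_to_def])
  then show "?B \<longlonglongrightarrow> 0" by simp
  show "\<forall>\<^sub>F i in sequentially. v (c i * d i - l * m) \<le> ?B i"
  proof (intro always_eventually allI)
    fix i
    have "c i * d i - l * m = (c i - l) * (d i - m) + l * (d i - m) + (c i - l) * m"
      by (simp add: algebra_simps)
    also have "v \<dots> \<le> ?B i"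
      using ultrametric[of "(c i - l) * (d i - m) + l * (d i - m)" "(c i - l) * m"]
        ultrametric[of "(c i - l) * (d i - m)" "l * (d i - m)"]
        abs_nonneg[of "(c i - l) * (d i - m)"] abs_nonneg[of "l * (d i - m)"] abs_nonneg[of "(c i - l) * m"]
      unfolding abs_mult by linarith
    finally show "v (c i * d i - l * m) \<le> ?B i" .
  qed
qed auto

lemma conv_to_power: "conv_to c l \<Longrightarrow> conv_to (\<lambda>i. c i ^ k) (l ^ k)"
  by (induction k) (auto intro: conv_to_const conv_to_mult)

lemma conv_to_sum: "(\<And>j. j \<in> J \<Longrightarrow> conv_to (\<lambda>i. c i j) (l j)) \<Longrightarrow> conv_to (\<lambda>i. \<Sum>j\<in>J. c i j) (\<Sum>j\<in>J. l j)"
  by (induction J rule: infinite_finite_induct) (auto intro: conv_to_const conv_to_add)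

lemma conv_to_prod: "(\<And>j. j \<in> J \<Longrightarrow> conv_to (\<lambda>i. c i j) (l j)) \<Longrightarrow> conv_to (\<lambda>i. \<Prod>j\<in>J. c i j) (\<Prod>j\<in>J. l j)"
  by (induction J rule: infinite_finite_induct) (auto intro: conv_to_const conv_to_mult)

lemma conv_to_subseq: "conv_to c l \<Longrightarrow> strict_mono r \<Longrightarrow> conv_to (\<lambda>i. c (r i)) l"
  unfolding conv_to_def by (drule (1) LIMSEQ_subseq_LIMSEQ) (simp add: comp_def)

lemma conv_to_unique:
  assumes "conv_to c l" "conv_to c m"
  shows "l = m"
proof -
  have "conv_to (\<lambda>i. c i + -1 * c i) (l + -1 * m)"
    by (intro conv_to_add conv_to_mult conv_to_const assms)
  then have "(\<lambda>i::nat. v (l - m)) \<longlonglongrightarrow> 0" by (simp add: conv_to_def abs_minus_commute)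
  then show ?thesis by (simp add: LIMSEQ_const_iff)
qed

lemma conv_to_eventually_close:
  assumes "conv_to c l" "e > 0"
  shows "\<exists>N. \<forall>i\<ge>N. v (c i - l) < e"
  using order_tendstoD(2)[OF assms[unfolded conv_to_def]] by (simp add: eventually_sequentially)

lemma Bolzano_Weierstrass_family:
  assumes "finite J" "\<And>(i::nat) j. j \<in> J \<Longrightarrow> v (c i j) \<le> B"
  shows "\<exists>l r. strict_mono r \<and> (\<forall>j\<in>J. conv_to (\<lambda>i. c (r i) j) (l j))"
  using assms
proof (induction J rule: finite_induct)
  case empty
  have "strict_mono (\<lambda>i::nat. i)" by (simp add: strict_mono_def)
  then have "\<exists>r::nat \<Rightarrow> nat. strict_mono r" by (rule exI[of strict_mono])
  then show ?case by simp
next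
  case (insert a J)
  then obtain l r where lr: "strict_mono r" "\<And>j. j \<in> J \<Longrightarrow> conv_to (\<lambda>i. c (r i) j) (l j)" by blast
  obtain m s where ms: "strict_mono s" "conv_to (\<lambda>i. c (r (s i)) a) m"
    using Bolzano_Weierstrass[of "\<lambda>i. c (r i) a" B] insert.prems unfolding conv_to_def by blast
  have "conv_to (\<lambda>i. c (r (s i)) j) ((l(a := m)) j)" if "j \<in> insert a J" for j
  proof (cases "j = a")
    case True
    then show ?thesis using ms(2) by simp
  next
    case False
    then show ?thesis using that conv_to_subseq[OF lr(2) ms(1)] by simp
  qed
  moreover have "strict_mono (\<lambda>i. r (s i))" using lr ms by (simp add: strict_mono_def)
  ultimately show ?case by blast
qed

text \<open>Otherwise there is a sequence in the open unit ball whose absolute values tend to \<open>1\<close>. A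
  limit point of it has absolute value \<open>1\<close>, but by the ultrametric inequality \<open>v\<close> is constant
  near such a point.\<close>
lemma discrete_abs: "\<exists>\<rho>. 0 < \<rho> \<and> \<rho> < 1 \<and> (\<forall>x. v x < 1 \<longrightarrow> v x \<le> \<rho>)"
proof (rule ccontr)
  assume neg: "\<not> ?thesis"
  have "\<exists>x. v x < 1 \<and> 1 - 1 / real (i + 2) < v x" for i :: nat
  proof -
    have "0 < 1 - 1 / real (i + 2)" "1 - 1 / real (i + 2) < 1" by (simp_all add: divide_simps)
    then have "\<not> (\<forall>x. v x < 1 \<longrightarrow> v x \<le> 1 - 1 / real (i + 2))" using neg by blast
    then show ?thesis by (auto simp only: not_all not_imp not_le)
  qed
  then have "\<forall>i::nat. \<exists>x. v x < 1 \<and> 1 - 1 / real (i + 2) < v x" by blast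
  then obtain c where "\<forall>i::nat. v (c i) < 1 \<and> 1 - 1 / real (i + 2) < v (c i)"
    by (rule choice[THEN exE])
  then have c: "\<And>i. v (c i) < 1" "\<And>i::nat. 1 - 1 / real (i + 2) < v (c i)" by simp_all
  obtain l r where r: "strict_mono r" and l: "conv_to (\<lambda>i. c (r i)) l"
    using Bolzano_Weierstrass[of c 1, OF less_imp_le[OF c(1)]] unfolding conv_to_def by blast
  have "(\<lambda>i. 1 - 1 / real (i + 2)) \<longlonglongrightarrow> 1 - 0"
    using LIMSEQ_ignore_initial_segment[OF lim_1_over_n, of 2] by (intro tendsto_diff tendsto_const) simp
  then have "(\<lambda>i. 1 - 1 / real (i + 2)) \<longlonglongrightarrow> 1" by simp
  then have "(\<lambda>i. v (c i)) \<longlonglongrightarrow> 1"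
  proof (rule tendsto_sandwich[rotated 2])
    show "\<forall>\<^sub>F i in sequentially. 1 - 1 / real (i + 2) \<le> v (c i)"
      by (rule always_eventually) (blast intro: less_imp_le c)
    show "\<forall>\<^sub>F i in sequentially. v (c i) \<le> 1"
      by (rule always_eventually) (blast intro: less_imp_le c)
  qed (rule tendsto_const)
  then have "(\<lambda>i. v (c (r i))) \<longlonglongrightarrow> 1"
    by (drule_tac LIMSEQ_subseq_LIMSEQ[OF _ r]) (simp only: comp_def)
  moreover have "(\<lambda>i. v (c (r i))) \<longlonglongrightarrow> v l"
    using l unfolding conv_to_def
  proof (rule metric_tendsto_imp_tendsto)
    show "\<forall>\<^sub>F i in sequentially. dist (v (c (r i))) (v l) \<le> dist (v (c (r i) - l)) 0"
      by (rule always_eventually) (simp add: dist_real_def abs_diff_le)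
  qed
  ultimately have "v l = 1" by (rule LIMSEQ_unique[symmetric])
  then have "0 < v l" by linarith
  then obtain N where N: "\<And>i. i \<ge> N \<Longrightarrow> v (c (r i) - l) < v l"
    using conv_to_eventually_close[OF l, of "v l"] by blast
  then have "v (c (r N)) = v l" by (intro abs_eq_if_close N order_refl)
  then show False using c(1)[of "r N"] \<open>v l = 1\<close> by simp
qed

text \<open>The residue field is finite: a sequence of pairwise incongruent elements of the unit ball
  would have no Cauchy subsequence.\<close>
lemma finite_residues: "\<exists>S. finite S \<and> (\<forall>x. v x \<le> 1 \<longrightarrow> (\<exists>s\<in>S. v (x - s) < 1))"
proof (rule ccontr)
  assume neg: "\<not> ?thesis"
  have "\<exists>c. \<forall>i::nat. v (c i) \<le> 1 \<and> (\<forall>j<i. 1 \<le> v (c i - c j))"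
  proof (rule dependent_wellorder_choice)
    fix c :: "nat \<Rightarrow> 'f" and i :: nat
    have "finite (c ` {..<i})" by simp
    then have "\<not> (\<forall>x. v x \<le> 1 \<longrightarrow> (\<exists>s\<in>c ` {..<i}. v (x - s) < 1))" using neg by blast
    then obtain x where "v x \<le> 1" "\<not> (\<exists>s\<in>c ` {..<i}. v (x - s) < 1)" by blast
    then have "v x \<le> 1 \<and> (\<forall>j<i. 1 \<le> v (x - c j))" by (simp add: not_less)
    then show "\<exists>x. v x \<le> 1 \<and> (\<forall>j<i. 1 \<le> v (x - c j))" by blast
  qed simp
  then obtain c where c: "\<And>i. v (c i) \<le> 1" "\<And>i j. j < (i::nat) \<Longrightarrow> 1 \<le> v (c i - c j)" by blast
  obtain l r where r: "strict_mono r" and l: "conv_to (\<lambda>i. c (r i)) l"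
    using Bolzano_Weierstrass[of c 1, OF c(1)] unfolding conv_to_def by blast
  obtain N where N: "\<And>i. i \<ge> N \<Longrightarrow> v (c (r i) - l) < 1" using conv_to_eventually_close[OF l, of 1] by auto
  have "c (r (Suc N)) - c (r N) = (c (r (Suc N)) - l) + (l - c (r N))" by simp
  then have "v (c (r (Suc N)) - c (r N)) < 1"
    using ultrametric[of "c (r (Suc N)) - l" "l - c (r N)"] N[of N] N[of "Suc N"] abs_minus_commute[of l "c (r N)"] by simp
  moreover have "r N < r (Suc N)" using r by (simp add: strict_mono_def)
  ultimately show False using c(2)[of "r N" "r (Suc N)"] by linarith
qed

end

section \<open>Extending the valuation ring to a larger field\<close>

text \<open>A valuation ring \<open>V\<close> of \<open>K\<close> that meets \<open>F\<close> in the unit ball. The field \<open>K\<close> may be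
  transcendental over \<open>F\<close>, where the value group of \<open>V\<close> need not embed into the reals, so
  values are compared through membership in \<open>V\<close>.\<close>
locale valuation_extension = local_abs v + field_hom \<iota>
  for v :: "'f::field \<Rightarrow> real" and \<iota> :: "'f \<Rightarrow> 'k::field" +
  fixes V :: "'k set"
  assumes V_1: "1 \<in> V"
    and V_diff: "x \<in> V \<Longrightarrow> y \<in> V \<Longrightarrow> x - y \<in> V"
    and V_mult: "x \<in> V \<Longrightarrow> y \<in> V \<Longrightarrow> x * y \<in> V"
    and V_total: "x \<notin> V \<Longrightarrow> inverse x \<in> V"
    and V_hom: "\<iota> a \<in> V \<longleftrightarrow> v a \<le> 1"

definition unital_subring :: "'k::field set \<Rightarrow> bool" where
  "unital_subring V \<longleftrightarrow> 1 \<in> V \<and> (\<forall>x\<in>V. \<forall>y\<in>V. x - y \<in> V \<and> x * y \<in> V)"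

context
  fixes V :: "'k::field set"
  assumes V: "unital_subring V"
begin

lemma subring_1: "1 \<in> V"
  and subring_diff: "x \<in> V \<Longrightarrow> y \<in> V \<Longrightarrow> x - y \<in> V"
  and subring_mult: "x \<in> V \<Longrightarrow> y \<in> V \<Longrightarrow> x * y \<in> V"
  using V by (auto simp: unital_subring_def)

lemma subring_0: "0 \<in> V"
  using subring_diff[OF subring_1 subring_1] by simp

lemma subring_add: "x \<in> V \<Longrightarrow> y \<in> V \<Longrightarrow> x + y \<in> V"
  using subring_diff[of x "0 - y"] subring_diff[OF subring_0] by simp

lemma subring_power: "x \<in> V \<Longrightarrow> x ^ k \<in> V"
  by (induction k) (auto intro: subring_1 subring_mult)

lemma subring_sum: "(\<And>i. i \<in> I \<Longrightarrow> f i \<in> V) \<Longrightarrow> sum f I \<in> V"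
  by (induction I rule: infinite_finite_induct) (auto intro: subring_0 subring_add)

definition adjoin :: "'k \<Rightarrow> 'k set" where
  "adjoin x = {poly p x |p. \<forall>i. coeff p i \<in> V}"

lemma unital_subring_adjoin: "unital_subring (adjoin x)"
  unfolding unital_subring_def
proof (intro conjI ballI)
  show "1 \<in> adjoin x"
    unfolding adjoin_def using subring_0 subring_1
    by (intro CollectI exI[of _ 1]) (auto simp: coeff_1)
next
  fix y z assume "y \<in> adjoin x" "z \<in> adjoin x"
  then obtain p q where p: "y = poly p x" "\<And>i. coeff p i \<in> V" and q: "z = poly q x" "\<And>i. coeff q i \<in> V"
    unfolding adjoin_def by blast
  show "y - z \<in> adjoin x"
    unfolding adjoin_def using p q
    by (intro CollectI exI[of _ "p - q"]) (auto intro: subring_diff)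
  show "y * z \<in> adjoin x"
    unfolding adjoin_def using p q
    by (intro CollectI exI[of _ "p * q"]) (auto simp: coeff_mult intro!: subring_sum subring_mult)
qed

lemma subset_adjoin: "V \<subseteq> adjoin x"
proof
  fix y assume "y \<in> V"
  then show "y \<in> adjoin x"
    unfolding adjoin_def using subring_0
    by (intro CollectI exI[of _ "[:y:]"]) (auto simp: coeff_pCons split: nat.split)
qed

lemma in_adjoin: "x \<in> adjoin x"
  unfolding adjoin_def using subring_0 subring_1
  by (intro CollectI exI[of _ "[:0, 1:]"]) (auto simp: coeff_pCons split: nat.split)

text \<open>This is the main step in the existence of valuation rings: a subring that is maximal among
  those that do not contain \<open>1 / w\<close> is a valuation ring. If neither \<open>x\<close> nor \<open>1 / x\<close> belonged to
  \<open>V\<close>, then \<open>1 / w\<close> would be a polynomial in \<open>x\<close> and a polynomial in \<open>1 / x\<close> over \<open>V\<close>. In two such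
  expressions of minimal degree, the one of smaller degree can be used to lower the degree of the other.
  This needs that elements of the form \<open>1 - w b\<close> are units of \<open>V\<close>, which holds by maximality too.\<close>
lemma maximal_subring_total:
  assumes w: "w \<noteq> 0" "w \<in> V" "inverse w \<notin> V"
    and max: "\<And>x. inverse w \<notin> adjoin x \<Longrightarrow> x \<in> V"
  shows "x \<in> V \<or> inverse x \<in> V"
proof -
  have rep: "\<exists>p. (\<forall>i. coeff p i \<in> V) \<and> poly p x = inverse w" if "x \<notin> V" for x
  proof -
    have "inverse w \<in> adjoin x" using max that by blast
    then obtain p where "inverse w = poly p x" "\<forall>i. coeff p i \<in> V" unfolding adjoin_def by blast
    then show ?thesis by (intro exI[of _ p]) simp
  qed
  have unit: "inverse (1 - w * b) \<in> V" if b: "b \<in> V" for b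
  proof (rule ccontr)
    define y where "y = 1 - w * b"
    assume "inverse (1 - w * b) \<notin> V"
    then obtain p where p: "\<And>i. coeff p i \<in> V" "poly p (inverse y) = inverse w"
      using rep unfolding y_def by blast
    have "y \<in> V" unfolding y_def using w b by (intro subring_diff subring_1 subring_mult)
    have "y \<noteq> 0"
    proof
      assume "y = 0"
      then have "w * b = 1" by (simp add: y_def)
      then have "inverse w = b" by (rule inverse_unique)
      then show False using w b by simp
    qed
    have "y ^ degree p * poly p (inverse y) = (\<Sum>i\<le>degree p. coeff p i * y ^ (degree p - i))"
      unfolding poly_altdef sum_distrib_left using \<open>y \<noteq> 0\<close>
      by (intro sum.cong refl) (auto simp: power_diff field_simps)
    also have "\<dots> \<in> V" using p \<open>y \<in> V\<close> by (intro subring_sum subring_mult subring_power)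
    finally have 1: "y ^ degree p * inverse w \<in> V" using p by simp
    \<comment> \<open>Since \<open>y = 1 - w b\<close>, every power of \<open>y\<close> is \<open>1\<close> modulo \<open>w\<close>.\<close>
    have 2: "(1 - y ^ k) * inverse w \<in> V" for k
    proof (induction k)
      case (Suc k)
      have "(1 - y ^ Suc k) * inverse w = (1 - y ^ k) * inverse w + y ^ k * b"
        using w by (simp add: y_def field_simps)
      also have "\<dots> \<in> V"
        by (rule subring_add[OF Suc subring_mult[OF subring_power[OF \<open>y \<in> V\<close>] b]])
      finally show ?case .
    qed (simp add: subring_0)
    have "inverse w = y ^ degree p * inverse w + (1 - y ^ degree p) * inverse w"
      by (simp add: algebra_simps)
    also have "\<dots> \<in> V" using 1 2 by (rule subring_add)
    finally show False using w by simp
  qed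
  have no_shorter: False
    if p: "\<And>i. coeff p i \<in> V" "poly p x = inverse w"
      and min: "\<And>q. (\<And>i. coeff q i \<in> V) \<Longrightarrow> poly q x = inverse w \<Longrightarrow> degree p \<le> degree q"
      and r: "\<And>i. coeff r i \<in> V" "poly r (inverse x) = inverse w" "degree r \<le> degree p"
      and x: "x \<noteq> 0" for x p r
  proof -
    define s where "s = degree r"
    define u where "u = inverse (1 - w * coeff r 0)"
    have u: "u \<in> V" unfolding u_def using r by (intro unit)
    have "1 - w * coeff r 0 \<noteq> 0"
    proof
      assume "1 - w * coeff r 0 = 0"
      then have "inverse w = coeff r 0" by (intro inverse_unique) simp
      then show False using w r by simp
    qed
    have "s \<noteq> 0"
    proof
      assume "s = 0"
      then have "poly r (inverse x) = coeff r 0" by (simp add: poly_altdef s_def)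
      then show False using w r by simp
    qed
    \<comment> \<open>The expression of smaller degree, solved for \<open>x^s\<close>, makes \<open>x\<close> integral of degree \<open>s\<close> over \<open>V\<close>.\<close>
    define t where "t = (\<Sum>i=1..s. monom (u * w * coeff r i) (s - i))"
    have "x ^ s = poly t x"
    proof -
      have "x ^ s = w * (x ^ s * poly r (inverse x))" using r w by simp
      also have "x ^ s * poly r (inverse x) = (\<Sum>i\<le>s. coeff r i * x ^ (s - i))"
        unfolding poly_altdef sum_distrib_left s_def[symmetric] using x
        by (intro sum.cong refl) (auto simp: power_diff field_simps)
      also have "\<dots> = coeff r 0 * x ^ s + (\<Sum>i=1..s. coeff r i * x ^ (s - i))"
        by (simp only: sum.atMost_shift sum.atLeast1_atMost_eq One_nat_def diff_zero)
      finally have "(1 - w * coeff r 0) * x ^ s = w * (\<Sum>i=1..s. coeff r i * x ^ (s - i))"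
        by (simp add: algebra_simps)
      then have "x ^ s = u * (w * (\<Sum>i=1..s. coeff r i * x ^ (s - i)))"
        using \<open>1 - w * coeff r 0 \<noteq> 0\<close> unfolding u_def by (simp add: field_simps)
      also have "\<dots> = poly t x"
        by (simp add: t_def poly_sum poly_monom sum_distrib_left mult_ac)
      finally show ?thesis .
    qed
    have t: "coeff t i \<in> V" for i
      unfolding t_def coeff_sum using u w r subring_0 by (intro subring_sum) (auto intro!: subring_mult)
    have deg_t: "degree t < s"
      unfolding t_def using \<open>s \<noteq> 0\<close>
      by (intro degree_sum_less) (auto intro!: le_less_trans[OF degree_monom_le])
    define d where "d = degree p"
    \<comment> \<open>Replace the leading term \<open>x^d\<close> of \<open>p\<close> by \<open>x^(d - s) t(x)\<close>.\<close>
    define q where "q = p - monom (coeff p d) d + monom (coeff p d) (d - s) * t"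
    have "poly q x = inverse w"
    proof -
      have "x ^ (d - s) * poly t x = x ^ d"
        using r by (simp add: \<open>x ^ s = poly t x\<close>[symmetric] d_def s_def power_add[symmetric])
      then show ?thesis using p by (simp add: q_def poly_monom mult.assoc)
    qed
    moreover have "coeff q i \<in> V" for i
      unfolding q_def coeff_add coeff_diff coeff_mult using p t subring_0
      by (intro subring_add subring_diff subring_sum subring_mult) auto
    moreover have "degree q < d"
    proof -
      have "d > 0" using \<open>s \<noteq> 0\<close> r by (simp add: d_def s_def)
      have "degree (p - monom (coeff p d) d) < d"
        using \<open>d > 0\<close> by (intro degree_lessI) (auto simp: d_def coeff_eq_0)
      moreover have "degree (monom (coeff p d) (d - s) * t) < d"
      proof -
        have "degree (monom (coeff p d) (d - s) * t) \<le> (d - s) + degree t"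
          by (rule order_trans[OF degree_mult_le]) (simp add: degree_monom_le)
        then show ?thesis using deg_t r by (simp add: d_def s_def)
      qed
      ultimately show ?thesis unfolding q_def by (intro degree_add_less)
    qed
    ultimately show False using min[of q] by (simp add: d_def)
  qed
  show ?thesis
  proof (rule ccontr)
    assume neg: "\<not> (x \<in> V \<or> inverse x \<in> V)"
    then have "x \<noteq> 0" using subring_0 by auto
    let ?P = "\<lambda>y p. (\<forall>i. coeff p i \<in> V) \<and> poly p y = inverse w"
    have least: "\<exists>p. ?P y p \<and> (\<forall>q. ?P y q \<longrightarrow> degree p \<le> degree q)" if "y \<notin> V" for y
      using rep[OF that] ex_has_least_nat[of "?P y" _ degree] by blast
    from neg have "x \<notin> V" "inverse x \<notin> V" by blast+
    from least[OF this(1)] obtain p where p: "?P x p" "\<And>q. ?P x q \<Longrightarrow> degree p \<le> degree q"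
      by blast
    from least[OF \<open>inverse x \<notin> V\<close>] obtain r
      where r: "?P (inverse x) r" "\<And>q. ?P (inverse x) q \<Longrightarrow> degree r \<le> degree q" by blast
    show False
    proof (cases "degree r \<le> degree p")
      case True
      then show False using no_shorter[of p x r] p r \<open>x \<noteq> 0\<close> by blast
    next
      case False
      then show False using no_shorter[of r "inverse x" p] p r \<open>x \<noteq> 0\<close> by simp
    qed
  qed
qed

end

text \<open>Zorn's lemma yields a maximal subring among those that contain the unit ball of \<open>F\<close> but not
  \<open>1 / W\<close>, where \<open>W\<close> is the image of some \<open>w\<close> with \<open>0 < v(w) < 1\<close>. It contains no other element
  of \<open>F\<close>: if \<open>v(a) > 1\<close>, then \<open>1 / w\<close> is a power of \<open>a\<close> times an element of the unit ball.\<close>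
lemma valuation_extension_exists:
  fixes v :: "'f::field \<Rightarrow> real" and \<iota> :: "'f \<Rightarrow> 'k::field"
  assumes "local_abs v" "field_hom \<iota>"
  obtains V where "valuation_extension v \<iota> V"
proof -
  interpret local_abs v by fact
  interpret field_hom \<iota> by fact
  obtain w where w: "w \<noteq> 0" "v w < 1" using nontrivial by blast
  define W where "W = \<iota> w"
  have "W \<noteq> 0" using w hom_mult[of w "inverse w"] by (auto simp: W_def)
  define A where "A = {V. unital_subring V \<and> \<iota> ` {a. v a \<le> 1} \<subseteq> V \<and> inverse W \<notin> V}"
  have "\<iota> ` {a. v a \<le> 1} \<in> A"
  proof -
    have "inverse W \<notin> \<iota> ` {a. v a \<le> 1}"
    proof
      assume "inverse W \<in> \<iota> ` {a. v a \<le> 1}"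
      then obtain a where a: "v a \<le> 1" "\<iota> a = inverse W" by auto
      then have "\<iota> (a * w - 1) = 0" using \<open>W \<noteq> 0\<close> by (simp add: hom_mult hom_minus W_def)
      then have "a * w - 1 = 0" using hom_mult[of "a * w - 1" "inverse (a * w - 1)"] by (cases "a * w - 1 = 0") auto
      then have "v a * v w = 1" by (simp add: abs_mult[symmetric])
      moreover have "v a * v w \<le> 1 * v w" using a by (intro mult_right_mono) auto
      ultimately show False using w by simp
    qed
    moreover have "unital_subring (\<iota> ` {a. v a \<le> 1})"
      unfolding unital_subring_def
    proof (intro conjI ballI)
      show "1 \<in> \<iota> ` {a. v a \<le> 1}" by (intro image_eqI[of _ _ 1]) auto
      fix x y assume "x \<in> \<iota> ` {a. v a \<le> 1}" "y \<in> \<iota> ` {a. v a \<le> 1}"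
      then obtain a b where ab: "x = \<iota> a" "y = \<iota> b" "v a \<le> 1" "v b \<le> 1" by auto
      show "x - y \<in> \<iota> ` {a. v a \<le> 1}"
        using ab by (intro image_eqI[of _ _ "a - b"]) (auto simp: hom_minus intro: ultrametric_diff_le)
      show "x * y \<in> \<iota> ` {a. v a \<le> 1}"
        using ab by (intro image_eqI[of _ _ "a * b"]) (auto simp: hom_mult abs_mult mult_le_one)
    qed
    ultimately show ?thesis by (simp add: A_def)
  qed
  moreover have "\<Union>C \<in> A" if "C \<noteq> {}" "subset.chain A C" for C
  proof -
    have C: "\<And>X. X \<in> C \<Longrightarrow> X \<in> A" and tot: "\<And>X Y. X \<in> C \<Longrightarrow> Y \<in> C \<Longrightarrow> X \<subseteq> Y \<or> Y \<subseteq> X"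
      using that by (auto simp: subset_chain_def)
    have "x - y \<in> \<Union>C \<and> x * y \<in> \<Union>C" if xy: "x \<in> \<Union>C" "y \<in> \<Union>C" for x y
    proof -
      obtain X Y where XY: "X \<in> C" "Y \<in> C" "x \<in> X" "y \<in> Y" using xy by blast
      then obtain Z where Z: "Z \<in> C" "x \<in> Z" "y \<in> Z" using tot[of X Y] by blast
      then have "unital_subring Z" using C by (auto simp: A_def)
      then show ?thesis using Z by (auto simp: unital_subring_def)
    qed
    moreover obtain X where "X \<in> C" using \<open>C \<noteq> {}\<close> by auto
    moreover have "unital_subring X" "\<iota> ` {a. v a \<le> 1} \<subseteq> X" using C \<open>X \<in> C\<close> by (auto simp: A_def)
    moreover have "1 \<in> \<Union>C" using calculation by (auto simp: unital_subring_def)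
    moreover have "inverse W \<notin> \<Union>C" using C by (auto simp: A_def)
    ultimately show ?thesis unfolding A_def unital_subring_def by blast
  qed
  ultimately obtain V where V: "V \<in> A" and max: "\<And>X. X \<in> A \<Longrightarrow> V \<subseteq> X \<Longrightarrow> X = V"
    using subset_Zorn_nonempty[of A] by blast
  have sub: "unital_subring V" and W: "inverse W \<notin> V" and int: "\<And>a. v a \<le> 1 \<Longrightarrow> \<iota> a \<in> V"
    using V by (auto simp: A_def)
  have total: "x \<in> V \<or> inverse x \<in> V" for x
  proof (rule maximal_subring_total[OF sub \<open>W \<noteq> 0\<close> _ W])
    show "W \<in> V" using int[of w] w by (simp add: W_def)
    fix x assume "inverse W \<notin> adjoin V x"
    then have "adjoin V x \<in> A"
      using unital_subring_adjoin[OF sub] subset_adjoin[OF sub] int by (auto simp: A_def)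
    then show "x \<in> V" using max[OF _ subset_adjoin[OF sub]] in_adjoin[OF sub] by blast
  qed
  have hom: "v a \<le> 1" if a: "\<iota> a \<in> V" for a
  proof (rule ccontr)
    assume "\<not> v a \<le> 1"
    then obtain k where k: "inverse (v w) < v a ^ k" using real_arch_pow[of "v a"] by auto
    have "a \<noteq> 0" using \<open>\<not> v a \<le> 1\<close> by auto
    have "v (inverse w / a ^ k) \<le> 1"
      using k \<open>a \<noteq> 0\<close> by (simp add: abs_divide abs_inverse abs_power divide_le_eq)
    then have "\<iota> a ^ k * \<iota> (inverse w / a ^ k) \<in> V"
      by (rule subring_mult[OF sub subring_power[OF sub a] int])
    also have "\<iota> a ^ k * \<iota> (inverse w / a ^ k) = inverse W"
      using \<open>a \<noteq> 0\<close> by (simp add: hom_power[symmetric] hom_mult[symmetric] hom_inverse[symmetric] W_def)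
    finally show False using W by simp
  qed
  have "valuation_extension v \<iota> V"
    by unfold_locales (use sub total hom int in \<open>auto simp: unital_subring_def\<close>)
  then show ?thesis by (rule that)
qed

section \<open>Units and non-units of the valuation ring\<close>

context valuation_extension
begin

lemma V_subring: "unital_subring V"
  using V_1 V_diff V_mult by (simp add: unital_subring_def)

lemmas V_0 = subring_0[OF V_subring]
  and V_add = subring_add[OF V_subring]
  and V_power = subring_power[OF V_subring]
  and V_sum = subring_sum[OF V_subring]

text \<open>The maximal ideal of \<open>V\<close>. Membership in \<open>V\<close> is implied, since \<open>x\<close> or its inverse lies in
  \<open>V\<close>; zero is listed separately because its inverse is zero by convention.\<close>
definition maxid :: "'k set" where
  "maxid = {x. x = 0 \<or> inverse x \<notin> V}"

definition val_unit :: "'k \<Rightarrow> bool" where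
  "val_unit x \<longleftrightarrow> x \<noteq> 0 \<and> x \<in> V \<and> inverse x \<in> V"

lemma maxid_subset: "x \<in> maxid \<Longrightarrow> x \<in> V"
  using V_total[of "inverse x"] V_0 by (auto simp: maxid_def)

lemma val_unit_iff: "val_unit x \<longleftrightarrow> x \<in> V \<and> x \<notin> maxid"
  by (auto simp: val_unit_def maxid_def)

lemma zero_in_maxid: "0 \<in> maxid"
  by (simp add: maxid_def)

lemma one_notin_maxid: "1 \<notin> maxid"
  using V_1 by (simp add: maxid_def)

lemma maxid_mult:
  assumes "x \<in> V" "y \<in> maxid"
  shows "x * y \<in> maxid"
proof (rule ccontr)
  assume neg: "x * y \<notin> maxid"
  then have nz: "x \<noteq> 0" "y \<noteq> 0" and inv: "inverse (x * y) \<in> V" by (auto simp: maxid_def)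
  have "x * inverse (x * y) = inverse y" using nz by (simp add: field_simps)
  then have "inverse y \<in> V" using V_mult[OF assms(1) inv] by (simp only: \<open>x * inverse (x * y) = inverse y\<close>)
  then show False using assms(2) nz by (simp add: maxid_def)
qed

lemma maxid_add:
  assumes x: "x \<in> maxid" and y: "y \<in> maxid"
  shows "x + y \<in> maxid"
proof (cases "x = 0 \<or> y = 0")
  case True
  then show ?thesis using assms by auto
next
  case False
  have *: "a + b \<in> maxid" if "a / b \<in> V" "b \<in> maxid" "b \<noteq> 0" for a b
  proof -
    have "(a / b + 1) * b \<in> maxid" using that V_1 by (intro maxid_mult V_add)
    also have "(a / b + 1) * b = a + b" using that by (simp add: field_simps)
    finally show ?thesis .
  qed
  show ?thesis
  proof (cases "x / y \<in> V")
    case True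
    then show ?thesis using *[of x y] y False by simp
  next
    case neg: False
    then have "y / x \<in> V" using V_total[of "x / y"] by (simp add: field_simps)
    then show ?thesis using *[of y x] x False by (simp add: add.commute)
  qed
qed

lemma maxid_sum: "(\<And>i. i \<in> I \<Longrightarrow> f i \<in> maxid) \<Longrightarrow> sum f I \<in> maxid"
  by (induction I rule: infinite_finite_induct) (auto intro: zero_in_maxid maxid_add)

lemma maxid_minus: "x \<in> maxid \<Longrightarrow> - x \<in> maxid"
  using maxid_mult[of "- 1" x] V_diff[OF V_0 V_1] by simp

lemma maxid_diff: "x \<in> maxid \<Longrightarrow> y \<in> maxid \<Longrightarrow> x - y \<in> maxid"
  using maxid_add[of x "- y"] maxid_minus[of y] by simp

lemma maxid_prime:
  assumes "x * y \<in> maxid"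
  shows "x \<in> maxid \<or> y \<in> maxid"
proof (rule ccontr)
  assume "\<not> ?thesis"
  then have "x \<noteq> 0" "y \<noteq> 0" "inverse x * inverse y \<in> V" by (auto simp: maxid_def intro: V_mult)
  then show False using assms by (simp add: maxid_def)
qed

lemma maxid_power_iff: "k > 0 \<Longrightarrow> x ^ k \<in> maxid \<longleftrightarrow> x \<in> maxid"
proof
  show "x ^ k \<in> maxid \<Longrightarrow> x \<in> maxid"
    by (induction k) (use one_notin_maxid maxid_prime in auto)
  assume "x \<in> maxid" "k > 0"
  then have "x ^ (k - 1) * x \<in> maxid" by (intro maxid_mult V_power maxid_subset)
  then show "x ^ k \<in> maxid" using \<open>k > 0\<close> by (simp only: power_minus_mult)
qed

lemma hom_eq_0_iff: "\<iota> a = 0 \<longleftrightarrow> a = 0"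
  using hom_mult[of a "inverse a"] by (cases "a = 0") auto

lemma hom_in_maxid_iff: "\<iota> a \<in> maxid \<longleftrightarrow> v a < 1"
proof (cases "a = 0")
  case False
  then have "\<iota> a \<in> maxid \<longleftrightarrow> \<not> v (inverse a) \<le> 1"
    by (simp add: maxid_def hom_eq_0_iff hom_inverse[symmetric] V_hom)
  also have "\<dots> \<longleftrightarrow> v a < 1"
    using False by (simp add: abs_inverse inverse_le_1_iff not_le)
  finally show ?thesis .
qed (simp add: zero_in_maxid)

lemma val_unit_hom_iff: "val_unit (\<iota> a) \<longleftrightarrow> v a = 1"
  by (auto simp: val_unit_iff V_hom hom_in_maxid_iff)

lemma val_unit_mult: "val_unit x \<Longrightarrow> val_unit y \<Longrightarrow> val_unit (x * y)"
  by (auto simp: val_unit_def V_mult)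

lemma val_unit_inverse: "val_unit x \<Longrightarrow> val_unit (inverse x)"
  by (auto simp: val_unit_def)

lemma val_unit_divide: "val_unit x \<Longrightarrow> val_unit y \<Longrightarrow> val_unit (x / y)"
  by (simp add: divide_inverse val_unit_mult val_unit_inverse)

lemma val_unit_power: "val_unit x \<Longrightarrow> val_unit (x ^ k)"
  by (auto simp: val_unit_def V_power power_inverse[symmetric])

lemma V_if_power:
  assumes "x ^ k \<in> V" "k > 0"
  shows "x \<in> V"
proof (rule ccontr)
  assume "x \<notin> V"
  then have "inverse x \<in> V" "x \<noteq> 0" using V_total V_0 by auto
  have "x ^ k * inverse x ^ (k - 1) \<in> V" by (rule V_mult[OF assms(1) V_power[OF \<open>inverse x \<in> V\<close>]])
  also have "x ^ k * inverse x ^ (k - 1) = x"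
    using \<open>x \<noteq> 0\<close> \<open>k > 0\<close> by (cases k) (auto simp: power_inverse)
  finally show False using \<open>x \<notin> V\<close> by simp
qed

lemma val_unit_if_power: "val_unit (x ^ k) \<Longrightarrow> k > 0 \<Longrightarrow> val_unit x"
  using V_if_power[of x k] V_if_power[of "inverse x" k]
  by (auto simp: val_unit_def power_inverse)

text \<open>The value group is totally ordered, so a finite family has an element of largest value.\<close>
lemma finite_max_in_V:
  assumes "finite J" "J \<noteq> {}" "\<And>j. j \<in> J \<Longrightarrow> t j \<noteq> 0"
  shows "\<exists>m\<in>J. \<forall>j\<in>J. t j / t m \<in> V"
  using assms
proof (induction J rule: finite_ne_induct)
  case (singleton a)
  then show ?case using V_1 by simp
next
  case (insert a J)
  then obtain m where m: "m \<in> J" "\<And>j. j \<in> J \<Longrightarrow> t j / t m \<in> V" by blast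
  have nz: "t a \<noteq> 0" "t m \<noteq> 0" using insert.prems m(1) by auto
  show ?case
  proof (cases "t a / t m \<in> V")
    case True
    then show ?thesis using m by blast
  next
    case False
    then have ma: "t m / t a \<in> V" using V_total[of "t a / t m"] by simp
    have "t j / t a \<in> V" if "j \<in> J" for j
      using V_mult[OF m(2)[OF that] ma] nz by simp
    then show ?thesis using nz V_1 by auto
  qed
qed

text \<open>In the relation \<open>P(x) = 0\<close> the largest value is attained by at least two terms \<open>a x^j\<close> and
  \<open>b x^m\<close>, so \<open>x^(j - m)\<close> has the value of \<open>b / a\<close>.\<close>
lemma root_value:
  assumes P: "P \<noteq> 0" "poly (map_poly \<iota> P) x = 0" and x: "x \<noteq> 0"
  shows "\<exists>i c. 0 < i \<and> i \<le> degree P \<and> c \<noteq> 0 \<and> val_unit (x ^ i / \<iota> c)"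
proof -
  define J where "J = {j. j \<le> degree P \<and> coeff P j \<noteq> 0}"
  define t where "t j = \<iota> (coeff P j) * x ^ j" for j
  have t: "t j \<noteq> 0" if "j \<in> J" for j
    using that x by (simp add: t_def J_def hom_eq_0_iff)
  have "finite J" by (simp add: J_def)
  moreover have "J \<noteq> {}" using P leading_coeff_0_iff[of P] by (auto simp: J_def)
  ultimately obtain m where m: "m \<in> J" "\<And>j. j \<in> J \<Longrightarrow> t j / t m \<in> V"
    using finite_max_in_V[of J t] t by blast
  have "poly (map_poly \<iota> P) x = (\<Sum>j\<le>degree P. t j)"
    unfolding t_def poly_altdef by (simp add: degree_map_poly coeff_map_poly hom_eq_0_iff)
  also have "\<dots> = sum t J"
    by (rule sum.mono_neutral_right) (auto simp: J_def t_def)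
  finally have "sum t J = 0" using P by simp
  then have "(\<Sum>j\<in>J. t j / t m) = 0" by (simp add: sum_divide_distrib[symmetric])
  then have sum0: "1 + (\<Sum>j\<in>J - {m}. t j / t m) = 0"
    using m t \<open>finite J\<close> by (simp add: sum.remove[of J m])
  have "\<exists>j\<in>J - {m}. t j / t m \<notin> maxid"
  proof (rule ccontr)
    assume "\<not> ?thesis"
    then have "- (\<Sum>j\<in>J - {m}. t j / t m) \<in> maxid" by (intro maxid_minus maxid_sum) blast
    moreover have "- (\<Sum>j\<in>J - {m}. t j / t m) = 1" using sum0 by (simp add: minus_unique add.commute)
    ultimately show False using one_notin_maxid by simp
  qed
  then obtain j where j: "j \<in> J" "j \<noteq> m" "t j / t m \<notin> maxid" by blast
  then have unit: "val_unit (t j / t m)" using m by (simp add: val_unit_iff)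
  have cnz: "coeff P j \<noteq> 0" "coeff P m \<noteq> 0" using j m by (auto simp: J_def)
  show ?thesis
  proof (cases "m < j")
    case True
    have "t j / t m = x ^ (j - m) / \<iota> (coeff P m / coeff P j)"
      using True x cnz by (simp add: t_def hom_div hom_eq_0_iff power_diff field_simps)
    then show ?thesis
      using unit True cnz j by (intro exI[of _ "j - m"] exI[of _ "coeff P m / coeff P j"]) (auto simp: J_def)
  next
    case False
    then have "j < m" using j by simp
    have "inverse (t j / t m) = x ^ (m - j) / \<iota> (coeff P j / coeff P m)"
      using \<open>j < m\<close> x cnz by (simp add: t_def hom_div hom_eq_0_iff power_diff field_simps)
    then show ?thesis
      using val_unit_inverse[OF unit] \<open>j < m\<close> cnz m
      by (intro exI[of _ "m - j"] exI[of _ "coeff P j / coeff P m"]) (auto simp: J_def)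
  qed
qed

lemma root_value_fact:
  assumes P: "P \<noteq> 0" "poly (map_poly \<iota> P) x = 0" "degree P \<le> d" and x: "x \<noteq> 0"
  shows "\<exists>c. c \<noteq> 0 \<and> val_unit (x ^ fact d / \<iota> c)"
proof -
  obtain i c where i: "0 < i" "i \<le> degree P" "c \<noteq> 0" "val_unit (x ^ i / \<iota> c)"
    using root_value[OF P(1,2) x] by blast
  have "i dvd fact d" using i P by (intro dvd_fact) auto
  then obtain k where k: "fact d = i * k" by (rule dvdE)
  have "(x ^ i / \<iota> c) ^ k = x ^ fact d / \<iota> (c ^ k)"
    by (simp add: k power_divide power_mult hom_power)
  then have "val_unit (x ^ fact d / \<iota> (c ^ k))" using val_unit_power[OF i(4), of k] by simp
  then show ?thesis using i(3) by (intro exI[of _ "c ^ k"]) auto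
qed

text \<open>Up to units, the power of exponent \<open>d!\<close> of \<open>x\<close> is an element \<open>c\<close> of \<open>F\<close>, and that of its
  \<open>q^k\<close>-th root is an element \<open>a\<close> of \<open>F\<close> with \<open>v(c) = v(a)^(q^k)\<close>. As \<open>v\<close> takes no values
  between some \<open>\<rho> < 1\<close> and \<open>1\<close>, this is possible for all \<open>k\<close> only if \<open>v(c) = 1\<close>.\<close>
lemma val_unit_if_infinitely_divisible:
  assumes q: "q \<ge> (2::nat)" and x: "x \<noteq> 0"
    and roots: "\<And>k. \<exists>y P. y ^ (q ^ k) = x \<and> P \<noteq> 0 \<and> degree P \<le> d \<and> poly (map_poly \<iota> P) y = 0"
  shows "val_unit x"
proof -
  have scaled: "\<exists>y c. y ^ (q ^ k) = x \<and> c \<noteq> 0 \<and> val_unit (y ^ fact d / \<iota> c)" for k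
  proof -
    obtain y P where y: "y ^ (q ^ k) = x" "P \<noteq> 0" "degree P \<le> d" "poly (map_poly \<iota> P) y = 0"
      using roots by blast
    have "y \<noteq> 0" using y(1) x q by (cases "y = 0") (auto simp: power_0_left)
    then show ?thesis using root_value_fact[OF y(2,4,3)] y(1) by blast
  qed
  obtain c where c: "c \<noteq> 0" "val_unit (x ^ fact d / \<iota> c)"
    using scaled[of 0] by auto
  obtain \<rho> where \<rho>: "0 < \<rho>" "\<rho> < 1" "\<And>a. v a < 1 \<Longrightarrow> v a \<le> \<rho>" using discrete_abs by blast
  have power: "\<exists>a. a \<noteq> 0 \<and> v c = v a ^ (q ^ k)" for k
  proof -
    obtain y a where a: "y ^ (q ^ k) = x" "a \<noteq> 0" "val_unit (y ^ fact d / \<iota> a)" using scaled by blast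
    have "(y ^ fact d / \<iota> a) ^ (q ^ k) = x ^ fact d / \<iota> (a ^ (q ^ k))"
      by (simp add: power_divide hom_power a(1)[symmetric] power_mult[symmetric] mult.commute)
    then have "val_unit (x ^ fact d / \<iota> (a ^ (q ^ k)))" using val_unit_power[OF a(3)] by metis
    then have "val_unit ((x ^ fact d / \<iota> (a ^ (q ^ k))) / (x ^ fact d / \<iota> c))" using c(2) by (rule val_unit_divide)
    also have "(x ^ fact d / \<iota> (a ^ (q ^ k))) / (x ^ fact d / \<iota> c) = \<iota> (c / a ^ (q ^ k))"
      using x c a by (simp add: hom_div hom_power hom_eq_0_iff field_simps)
    finally have "v c / v a ^ (q ^ k) = 1" by (simp only: val_unit_hom_iff abs_divide abs_power)
    then have "v c = v a ^ (q ^ k)" by (simp only: divide_eq_1_iff)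
    then show ?thesis using a(2) by blast
  qed
  have small: False if b: "0 < b" "b < 1" "\<And>k. \<exists>a. b = v a ^ (q ^ k)" for b :: real
  proof -
    have "(\<lambda>k. \<rho> ^ k) \<longlonglongrightarrow> 0" using \<rho> by (intro LIMSEQ_power_zero) auto
    then obtain k where k: "\<rho> ^ k < b"
      using order_tendstoD(2)[of "\<lambda>k. \<rho> ^ k" 0 sequentially b] b(1) by (auto simp: eventually_sequentially)
    obtain a where a: "b = v a ^ (q ^ k)" using b(3) by blast
    have "v a < 1"
    proof (rule ccontr)
      assume "\<not> v a < 1"
      then have "1 \<le> v a ^ (q ^ k)" by (intro one_le_power) simp
      then show False using a b(2) by simp
    qed
    then have "v a \<le> \<rho>" by (rule \<rho>(3))
    then have "b \<le> \<rho> ^ (q ^ k)" unfolding a by (intro power_mono) auto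
    also have "\<dots> \<le> \<rho> ^ k"
    proof (rule power_decreasing)
      have "k < 2 ^ k" by (rule less_exp)
      also have "(2::nat) ^ k \<le> q ^ k" using q by (rule power_mono) simp
      finally show "k \<le> q ^ k" by simp
    qed (use \<rho> in auto)
    finally show False using k by simp
  qed
  have "\<not> v c < 1"
    using small[of "v c"] c(1) power by auto
  moreover have "\<not> v c > 1"
  proof
    assume "v c > 1"
    have "\<exists>a. inverse (v c) = v a ^ (q ^ k)" for k
    proof -
      obtain a where "v c = v a ^ (q ^ k)" using power by blast
      then show ?thesis by (intro exI[of _ "inverse a"]) (simp add: abs_inverse power_inverse)
    qed
    then show False using small[of "inverse (v c)"] \<open>v c > 1\<close> c(1) by (auto simp: inverse_less_1_iff)
  qed
  ultimately have "v c = 1" by simp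
  then have "val_unit (x ^ fact d / \<iota> c * \<iota> c)" using c by (intro val_unit_mult) (auto simp: val_unit_hom_iff)
  then have "val_unit (x ^ fact d)" using c(1) by (simp add: hom_eq_0_iff)
  then show ?thesis by (rule val_unit_if_power) simp
qed

end

section \<open>Powers and eigenvalues of matrices\<close>

lemma poly_mat_monom_diff_1:
  fixes A :: "'a::comm_ring_1 mat"
  assumes A: "A \<in> carrier_mat n n"
  shows "poly_mat n (monom 1 m - 1) A = A ^\<^sub>m m - 1\<^sub>m n"
proof -
  have "poly_mat n (monom 1 m + [:-1:]) A = A ^\<^sub>m m + (-1) \<cdot>\<^sub>m 1\<^sub>m n"
    using A by (simp only: poly_mat_add poly_mat_monom poly_mat_const)
  also have "monom 1 m + [:-1:] = (monom 1 m - 1 :: 'a poly)" by (simp add: one_pCons)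
  also have "A ^\<^sub>m m + (-1) \<cdot>\<^sub>m 1\<^sub>m n = A ^\<^sub>m m - 1\<^sub>m n"
    using A by (intro eq_matI) auto
  finally show ?thesis .
qed

lemma freshmans_dream_diff_1:
  fixes x :: "'a::comm_ring_1"
  assumes "prime CHAR('a)" "P = CHAR('a) ^ k"
  shows "(x - 1) ^ P = x ^ P - 1"
  using freshmans_dream'[OF assms, of "x - 1" 1] by (simp add: algebra_simps)

lemma freshmans_dream_mat:
  fixes A :: "'a::comm_ring_1 mat"
  assumes char: "prime CHAR('a)" and P: "P = CHAR('a) ^ k" and A: "A \<in> carrier_mat n n"
  shows "(A - 1\<^sub>m n) ^\<^sub>m P = A ^\<^sub>m P - 1\<^sub>m n"
proof -
  have lin: "poly_mat n (monom 1 1 - 1) A = A - 1\<^sub>m n"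
    using poly_mat_monom_diff_1[OF A, of 1] A by simp
  have "(monom 1 1 - 1) ^ P = (monom 1 1 ^ P - 1 :: 'a poly)"
    using char P by (intro freshmans_dream_diff_1[of _ k]) simp_all
  also have "monom 1 1 ^ P = (monom 1 P :: 'a poly)" by (simp add: monom_power)
  finally have "poly_mat n ((monom 1 1 - 1) ^ P) A = A ^\<^sub>m P - 1\<^sub>m n"
    using poly_mat_monom_diff_1[OF A] by simp
  then show ?thesis by (simp only: poly_mat_power[OF A] lin)
qed

lemma pow_mat_mult:
  fixes A :: "'a::comm_ring_1 mat"
  assumes A: "A \<in> carrier_mat n n"
  shows "A ^\<^sub>m (a * b) = (A ^\<^sub>m a) ^\<^sub>m b"
proof -
  have "A ^\<^sub>m (a * b) = poly_mat n (monom 1 a ^ b) A"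
    using poly_mat_monom[OF A, of "a * b"] by (simp add: monom_power)
  then show ?thesis by (simp only: poly_mat_power[OF A] poly_mat_monom[OF A])
qed

lemma pow_mat_add:
  fixes A :: "'a::comm_ring_1 mat"
  assumes A: "A \<in> carrier_mat n n"
  shows "A ^\<^sub>m (a + b) = A ^\<^sub>m a * A ^\<^sub>m b"
  using poly_mat_mult[OF A, of "monom 1 a" "monom 1 b"]
  by (simp add: poly_mat_monom[OF A] mult_monom)

lemma (in comm_ring_hom) poly_mat_hom:
  assumes A: "A \<in> carrier_mat n n"
  shows "map_mat hom (poly_mat n f A) = poly_mat n (map_poly hom f) (map_mat hom A)"
proof (rule eq_matI)
  have A': "map_mat hom A \<in> carrier_mat n n" using A by simp
  fix i j assume "i < dim_row (poly_mat n (map_poly hom f) (map_mat hom A))"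
    "j < dim_col (poly_mat n (map_poly hom f) (map_mat hom A))"
  then have ij: "i < n" "j < n" using A' by simp_all
  have *: "hom ((A ^\<^sub>m k) $$ (i, j)) = (map_mat hom A ^\<^sub>m k) $$ (i, j)" for k
    using ij A by (simp add: mat_hom_pow[OF A, symmetric])
  have "map_mat hom (poly_mat n f A) $$ (i, j) =
      hom (\<Sum>k<Suc (degree f). coeff f k * (A ^\<^sub>m k) $$ (i, j))"
    using ij A by (simp add: poly_mat_index[OF A, of i j f "Suc (degree f)"] del: sum.lessThan_Suc)
  also have "\<dots> = (\<Sum>k<Suc (degree f). coeff (map_poly hom f) k * (map_mat hom A ^\<^sub>m k) $$ (i, j))"
    by (simp only: hom_sum hom_mult * coeff_map_poly hom_zero)
  also have "\<dots> = poly_mat n (map_poly hom f) (map_mat hom A) $$ (i, j)"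
    using ij by (intro poly_mat_index[OF A', symmetric]) (auto simp: less_Suc_eq_le degree_map_poly_le)
  finally show "map_mat hom (poly_mat n f A) $$ (i, j) =
      poly_mat n (map_poly hom f) (map_mat hom A) $$ (i, j)" .
qed (use A in auto)

text \<open>By Cayley-Hamilton, each entry of \<open>A^m\<close> is a linear recurrence sequence in \<open>m\<close>. All growth
  estimates for powers of matrices are reduced to this scalar recurrence.\<close>
lemma char_poly_recurrence:
  fixes A :: "'a::comm_ring_1 mat"
  assumes A: "A \<in> carrier_mat n n" and ij: "i < n" "j < n"
  shows "(A ^\<^sub>m (m + n)) $$ (i, j) = - (\<Sum>k<n. coeff (char_poly A) k * (A ^\<^sub>m (m + k)) $$ (i, j))"
proof -
  let ?c = "char_poly A"
  have deg: "degree ?c = n" "coeff ?c n = 1"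
    using degree_monic_char_poly[OF A] by auto
  have "poly_mat n (monom 1 m * ?c) A = 0\<^sub>m n n"
    using A by (simp add: poly_mat_mult[OF A] Cayley_Hamilton[OF A] poly_mat_monom[OF A] right_mult_zero_mat[of _ n n])
  moreover have "degree (monom 1 m * ?c) < Suc n + m"
    using degree_mult_le[of "monom 1 m" ?c] degree_monom_le[of "1::'a" m] deg by simp
  ultimately have "0 = (\<Sum>k<Suc n + m. coeff (monom 1 m * ?c) k * (A ^\<^sub>m k) $$ (i, j))"
    using poly_mat_index[OF A ij, of "monom 1 m * ?c" "Suc n + m"] ij by simp
  also have "\<dots> = (\<Sum>k\<in>{m..<Suc n + m}. coeff ?c (k - m) * (A ^\<^sub>m k) $$ (i, j))"
    by (rule sum.mono_neutral_cong_right) (auto simp: coeff_monom_mult)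
  also have "\<dots> = (\<Sum>k<Suc n. coeff ?c k * (A ^\<^sub>m (m + k)) $$ (i, j))"
    using sum.shift_bounds_nat_ivl[of "\<lambda>k. coeff ?c (k - m) * (A ^\<^sub>m k) $$ (i, j)" 0 m "Suc n"]
    by (simp add: atLeast0LessThan add.commute)
  finally show ?thesis using deg by (simp add: eq_neg_iff_add_eq_0 add.commute)
qed

text \<open>Each \<open>n\<close> steps of the recurrence gain a factor \<open>\<rho>\<close>. The case \<open>\<rho> = 1\<close> gives boundedness and the
  case \<open>\<rho> < 1\<close> gives convergence to zero.\<close>
lemma (in local_abs) recurrence_bound:
  assumes rec: "\<And>m. u (m + n) = - (\<Sum>k<n. d k * u (m + k))"
    and d: "\<And>k. k < n \<Longrightarrow> v (d k) \<le> \<rho>" and \<rho>: "0 \<le> \<rho>" "\<rho> \<le> 1"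
    and B: "\<And>k. k < n \<Longrightarrow> v (u k) \<le> B" "0 \<le> B"
  shows "v (u m) \<le> B * \<rho> ^ (m div n)"
proof (induction m rule: less_induct)
  case (less m)
  show ?case
  proof (cases "m < n")
    case True
    then show ?thesis using B by simp
  next
    case False
    define l where "l = m - n"
    have m: "m = l + n" using False by (simp add: l_def)
    show ?thesis
    proof (cases "n = 0")
      case True
      then show ?thesis using rec[of m] B(2) by simp
    next
      case n: False
      have "v (d k * u (l + k)) \<le> B * \<rho> ^ (m div n)" if "k < n" for k
      proof -
        have "v (u (l + k)) \<le> B * \<rho> ^ ((l + k) div n)" using that m by (intro less) simp
        also have "\<dots> \<le> B * \<rho> ^ (l div n)"
          using \<rho> B(2) by (intro mult_left_mono power_decreasing div_le_mono) auto
        finally have "v (d k) * v (u (l + k)) \<le> \<rho> * (B * \<rho> ^ (l div n))"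
          using d[OF that] \<rho>(1) by (intro mult_mono) auto
        also have "\<dots> = B * \<rho> ^ (m div n)" using n m by simp
        finally show ?thesis by (simp add: abs_mult)
      qed
      then have "v (\<Sum>k<n. d k * u (l + k)) \<le> B * \<rho> ^ (m div n)"
        using B(2) \<rho>(1) by (intro ultrametric_sum_le) auto
      then show ?thesis using rec[of l] m by simp
    qed
  qed
qed

locale closed_valuation_extension = valuation_extension v \<iota> V
  for v :: "'f::field \<Rightarrow> real" and \<iota> :: "'f \<Rightarrow> 'k::alg_closed_field" and V +
  assumes CHAR_pos: "CHAR('f) > 0"
begin

lemma CHAR_prime: "prime CHAR('f)"
  using CHAR_pos by (rule prime_CHAR_semidom)

lemma CHAR_extension: "CHAR('k) = CHAR('f)"
proof (rule dvd_antisym)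
  show "CHAR('k) dvd CHAR('f)"
  proof -
    have "of_nat CHAR('f) = \<iota> (of_nat CHAR('f))" by (rule hom_of_nat[symmetric])
    also have "\<dots> = 0" by (simp only: of_nat_CHAR hom_zero)
    finally show ?thesis by (simp only: of_nat_eq_0_iff_char_dvd)
  qed
  have "\<iota> (of_nat CHAR('k)) = of_nat CHAR('k)" by (rule hom_of_nat)
  also have "\<dots> = 0" by (rule of_nat_CHAR)
  finally show "CHAR('f) dvd CHAR('k)" by (simp only: hom_eq_0_iff of_nat_eq_0_iff_char_dvd)
qed

text \<open>The eigenvalues in the algebraically closed field \<open>K\<close> of a matrix over \<open>F\<close>, as the roots of
  its characteristic polynomial.\<close>
definition eigs :: "'f mat \<Rightarrow> 'k set" where
  "eigs A = {e. poly (map_poly \<iota> (char_poly A)) e = 0}"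

lemma eigs_iff: "A \<in> carrier_mat n n \<Longrightarrow> e \<in> eigs A \<longleftrightarrow> poly (char_poly (map_mat \<iota> A)) e = 0"
  by (simp add: eigs_def char_poly_hom)

lemma eigs_poly_mat:
  assumes A: "A \<in> carrier_mat n n" and f: "degree f > 0"
  shows "eigs (poly_mat n f A) = poly (map_poly \<iota> f) ` eigs A"
proof -
  have A': "map_mat \<iota> A \<in> carrier_mat n n" using A by simp
  have "degree (map_poly \<iota> f) > 0" using f by (simp add: degree_map_poly hom_eq_0_iff)
  note spec = spectral_mapping[OF A' this]
  show ?thesis
  proof (rule Set.set_eqI)
    fix c
    have "c \<in> eigs (poly_mat n f A) \<longleftrightarrow> (\<exists>e. e \<in> eigs A \<and> poly (map_poly \<iota> f) e = c)"
      by (simp only: eigs_iff[OF A] eigs_iff[OF poly_mat_carrier[OF A]] poly_mat_hom[OF A] spec)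
    then show "c \<in> eigs (poly_mat n f A) \<longleftrightarrow> c \<in> poly (map_poly \<iota> f) ` eigs A" by blast
  qed
qed

lemma map_poly_hom_monom: "map_poly \<iota> (monom 1 m) = monom 1 m"
  by (simp add: map_poly_monom)

lemma eigs_pow:
  assumes "A \<in> carrier_mat n n" "m > 0"
  shows "eigs (A ^\<^sub>m m) = (\<lambda>e. e ^ m) ` eigs A"
  using eigs_poly_mat[OF assms(1), of "monom 1 m"] assms
  by (simp add: poly_mat_monom degree_monom_eq map_poly_hom_monom poly_monom)

lemma eigs_pow_diff_1:
  assumes A: "A \<in> carrier_mat n n" and m: "m > 0"
  shows "eigs (A ^\<^sub>m m - 1\<^sub>m n) = (\<lambda>e. e ^ m - 1) ` eigs A"
proof -
  have "coeff (monom 1 m - 1 :: 'f poly) m = 1" using m by (simp add: coeff_1)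
  then have "m \<le> degree (monom 1 m - 1 :: 'f poly)" by (intro le_degree) simp
  moreover have "map_poly \<iota> (monom 1 m - 1) = monom 1 m - 1"
    by (rule poly_eqI) (simp add: coeff_map_poly hom_minus coeff_1)
  ultimately show ?thesis
    using eigs_poly_mat[OF A, of "monom 1 m - 1"] m
    by (simp add: poly_mat_monom_diff_1[OF A] poly_monom)
qed

lemma char_poly_split:
  assumes A: "A \<in> carrier_mat n n"
  obtains R where "size R = n" "map_poly \<iota> (char_poly A) = (\<Prod>x\<in>#R. [:- x, 1:])" "set_mset R = eigs A"
proof -
  let ?c = "map_poly \<iota> (char_poly A)"
  have deg: "degree ?c = n" and monic: "lead_coeff ?c = 1"
    using degree_monic_char_poly[OF A] by (simp_all add: degree_map_poly hom_eq_0_iff coeff_map_poly)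
  then have "?c \<noteq> 0" by auto
  then obtain R where R: "size R = n" "?c = smult (lead_coeff ?c) (\<Prod>x\<in>#R. [:- x, 1:])"
    using alg_closed_imp_factorization[of ?c] deg by blast
  then have eq: "?c = (\<Prod>x\<in>#R. [:- x, 1:])" using R(2) by (simp only: monic smult_1_left)
  have "set_mset R = eigs A"
    unfolding eigs_def eq by (auto simp: poly_prod_mset prod_mset_zero_iff)
  then show ?thesis using R(1) eq that by blast
qed

lemma coeff_prod_in_V:
  assumes "\<And>x. x \<in># R \<Longrightarrow> x \<in> V"
  shows "coeff (\<Prod>x\<in>#R. [:- x, 1:]) i \<in> V"
  using assms
proof (induction R arbitrary: i)
  case empty
  then show ?case by (simp add: coeff_1 V_0 V_1)
next
  case (add x R)
  let ?P = "\<Prod>x\<in>#R. [:- x, 1:]"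
  have "coeff ([:- x, 1:] * ?P) i = (case i of 0 \<Rightarrow> 0 | Suc j \<Rightarrow> coeff ?P j) - x * coeff ?P i"
    by (simp add: coeff_pCons split: nat.split)
  moreover have "\<dots> \<in> V"
    using add V_0 by (intro V_diff V_mult) (auto split: nat.split)
  ultimately show ?case by simp
qed

lemma coeff_prod_in_maxid:
  assumes "\<And>x. x \<in># R \<Longrightarrow> x \<in> maxid" "i < size R"
  shows "coeff (\<Prod>x\<in>#R. [:- x, 1:]) i \<in> maxid"
  using assms
proof (induction R arbitrary: i)
  case empty
  then show ?case by simp
next
  case (add x R)
  let ?P = "\<Prod>x\<in>#R. [:- x, 1:]"
  have "coeff ([:- x, 1:] * ?P) i = (case i of 0 \<Rightarrow> 0 | Suc j \<Rightarrow> coeff ?P j) - coeff ?P i * x"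
    by (simp add: coeff_pCons split: nat.split)
  moreover have "(case i of 0 \<Rightarrow> 0 | Suc j \<Rightarrow> coeff ?P j) - coeff ?P i * x \<in> maxid"
  proof (rule maxid_diff)
    show "(case i of 0 \<Rightarrow> 0 | Suc j \<Rightarrow> coeff ?P j) \<in> maxid"
      using add zero_in_maxid by (auto split: nat.split)
    show "coeff ?P i * x \<in> maxid"
      using add.prems(1) maxid_subset by (intro maxid_mult coeff_prod_in_V) auto
  qed
  ultimately show ?case by (simp add: mult.commute)
qed

lemma char_poly_integral:
  assumes "A \<in> carrier_mat n n" "eigs A \<subseteq> V"
  shows "v (coeff (char_poly A) i) \<le> 1"
proof -
  obtain R where R: "map_poly \<iota> (char_poly A) = (\<Prod>x\<in>#R. [:- x, 1:])" "set_mset R = eigs A"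
    using char_poly_split[OF assms(1)] by blast
  have "coeff (map_poly \<iota> (char_poly A)) i \<in> V"
    unfolding R(1) by (rule coeff_prod_in_V) (use R(2) assms(2) in blast)
  then show ?thesis by (simp add: coeff_map_poly V_hom)
qed

lemma char_poly_contracting:
  assumes "A \<in> carrier_mat n n" "eigs A \<subseteq> maxid" "i < n"
  shows "v (coeff (char_poly A) i) < 1"
proof -
  obtain R where R: "size R = n" "map_poly \<iota> (char_poly A) = (\<Prod>x\<in>#R. [:- x, 1:])" "set_mset R = eigs A"
    using char_poly_split[OF assms(1)] by blast
  have "coeff (map_poly \<iota> (char_poly A)) i \<in> maxid"
    unfolding R(2) by (rule coeff_prod_in_maxid) (use R(1,3) assms(2,3) in auto)
  then show ?thesis by (simp add: coeff_map_poly hom_in_maxid_iff)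
qed

text \<open>The characteristic polynomial is \<open>X^n\<close>, so Cayley-Hamilton applies.\<close>
lemma nilpotent_if_eigs_0:
  assumes A: "A \<in> carrier_mat n n" and eigs: "eigs A \<subseteq> {0}"
  shows "A ^\<^sub>m n = 0\<^sub>m n n"
proof -
  obtain R where R: "size R = n" "map_poly \<iota> (char_poly A) = (\<Prod>x\<in>#R. [:- x, 1:])" "set_mset R = eigs A"
    using char_poly_split[OF A] by blast
  have "(\<Prod>x\<in>#R. [:- x, 1:]) = monom 1 (size R)" if "set_mset R \<subseteq> {0}" for R :: "'k multiset"
    using that by (induction R) (simp_all add: monom_Suc)
  then have eq: "map_poly \<iota> (char_poly A) = monom 1 n" using R eigs by simp
  have "char_poly A = monom 1 n"
  proof (rule poly_eqI)
    fix i
    have "\<iota> (coeff (char_poly A) i - coeff (monom 1 n) i) = 0"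
      using arg_cong[OF eq, of "\<lambda>p. coeff p i"] by (simp add: coeff_map_poly hom_minus)
    then show "coeff (char_poly A) i = coeff (monom 1 n) i" by (simp only: hom_eq_0_iff right_minus_eq)
  qed
  then show ?thesis using Cayley_Hamilton[OF A] by (simp add: poly_mat_monom[OF A])
qed

lemma powers_bounded:
  assumes A: "A \<in> carrier_mat n n" and eigs: "eigs A \<subseteq> V"
  shows "\<exists>B. \<forall>m i j. i < n \<longrightarrow> j < n \<longrightarrow> v ((A ^\<^sub>m m) $$ (i, j)) \<le> B"
proof -
  define E where "E = (\<lambda>(k, i, j). v ((A ^\<^sub>m k) $$ (i, j))) ` ({..<n} \<times> {..<n} \<times> {..<n})"
  define B where "B = Max (insert 0 E)"
  have "finite E" by (simp add: E_def)
  have "0 \<le> B" unfolding B_def using \<open>finite E\<close> by (intro Max_ge) auto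
  have B: "v ((A ^\<^sub>m k) $$ (i, j)) \<le> B" if "k < n" "i < n" "j < n" for k i j
  proof -
    have "v ((A ^\<^sub>m k) $$ (i, j)) \<in> E"
      unfolding E_def using that by (intro image_eqI[of _ _ "(k, i, j)"]) auto
    then show ?thesis unfolding B_def using \<open>finite E\<close> by (intro Max_ge) auto
  qed
  have "v ((A ^\<^sub>m m) $$ (i, j)) \<le> B" if ij: "i < n" "j < n" for m i j
  proof -
    have "v ((A ^\<^sub>m m) $$ (i, j)) \<le> B * 1 ^ (m div n)"
      using B[OF _ ij] \<open>0 \<le> B\<close>
      by (intro recurrence_bound[OF char_poly_recurrence[OF A ij] char_poly_integral[OF A eigs]]) simp_all
    then show ?thesis by simp
  qed
  then show ?thesis by blast
qed

lemma powers_tendsto_0: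
  assumes A: "A \<in> carrier_mat n n" and eigs: "eigs A \<subseteq> maxid" and ij: "i < n" "j < n"
  shows "conv_to (\<lambda>m. (A ^\<^sub>m m) $$ (i, j)) 0"
proof -
  obtain \<rho> where \<rho>: "0 < \<rho>" "\<rho> < 1" "\<And>a. v a < 1 \<Longrightarrow> v a \<le> \<rho>" using discrete_abs by blast
  obtain B where B: "\<And>m. v ((A ^\<^sub>m m) $$ (i, j)) \<le> B"
    using powers_bounded[OF A] eigs maxid_subset ij by blast
  have "0 \<le> B" using B[of 0] abs_nonneg order_trans by blast
  have le: "v ((A ^\<^sub>m m) $$ (i, j)) \<le> B * \<rho> ^ (m div n)" for m
    using \<rho>(1,2) \<open>0 \<le> B\<close>
    by (intro recurrence_bound[OF char_poly_recurrence[OF A ij] \<rho>(3)[OF char_poly_contracting[OF A eigs]]] B)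
      simp_all
  have "(\<lambda>k. \<rho> ^ k) \<longlonglongrightarrow> 0" using \<rho> by (intro LIMSEQ_power_zero) auto
  moreover have "filterlim (\<lambda>m. m div n) at_top sequentially"
    using ij by (intro filterlim_at_top_div_const_nat) simp
  ultimately have "(\<lambda>m. \<rho> ^ (m div n)) \<longlonglongrightarrow> 0" by (rule filterlim_compose)
  then have lim: "(\<lambda>m. B * \<rho> ^ (m div n)) \<longlonglongrightarrow> 0" by (rule tendsto_mult_right_zero)
  show ?thesis unfolding conv_to_def
    by (rule tendsto_sandwich[OF _ _ tendsto_const lim]) (simp_all add: le)
qed

text \<open>Modulo the maximal ideal there are only finitely many monic polynomials of degree \<open>n\<close> over the
  unit ball. Let \<open>R\<close> consist of the roots of one representative \<open>Q\<close> of each class. If \<open>P\<close> is congruent to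
  \<open>Q\<close> and \<open>P(x) = 0\<close>, then \<open>Q(x)\<close> lies in the maximal ideal, which is prime, so some factor
  \<open>x - r\<close> of \<open>Q(x)\<close> lies in it.\<close>
lemma finite_residues_of_roots:
  obtains R :: "'k set" where "finite R"
    "\<forall>P x. degree P = n \<and> lead_coeff P = 1 \<and> (\<forall>i. v (coeff P i) \<le> 1) \<and>
       x \<in> V \<and> poly (map_poly \<iota> P) x = 0 \<longrightarrow> (\<exists>r\<in>R. x - r \<in> maxid)"
proof -
  note result = that
  obtain S where S: "finite S" "\<And>a. v a \<le> 1 \<Longrightarrow> \<exists>s\<in>S. v (a - s) < 1" using finite_residues by blast
  define Q where "Q xs = Poly xs + monom 1 n" for xs :: "'f list"
  define L where "L = {xs. set xs \<subseteq> S \<and> length xs = n}"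
  define R where "R = (\<Union>xs\<in>L. {r. poly (map_poly \<iota> (Q xs)) r = 0})"
  have Q: "coeff (Q xs) i = (if i < n then xs ! i else if i = n then 1 else 0)" if "length xs = n" for xs i
    using that by (auto simp: Q_def coeff_Poly_eq nth_default_def)
  have monic: "degree (map_poly \<iota> (Q xs)) = n" "lead_coeff (map_poly \<iota> (Q xs)) = 1" if "length xs = n" for xs
  proof -
    have "degree (Q xs) = n"
      using Q[OF that] by (intro antisym degree_le le_degree) auto
    then show "degree (map_poly \<iota> (Q xs)) = n" by (simp add: degree_map_poly hom_eq_0_iff)
    then show "lead_coeff (map_poly \<iota> (Q xs)) = 1" using Q[OF that] by (simp add: coeff_map_poly)
  qed
  have "finite L" unfolding L_def using S(1) by (rule finite_lists_length_eq)
  moreover have "finite {r. poly (map_poly \<iota> (Q xs)) r = 0}" if "xs \<in> L" for xs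
    using monic(2)[of xs] that by (intro poly_roots_finite) (auto simp: L_def)
  ultimately have "finite R" unfolding R_def by blast
  moreover have "\<exists>r\<in>R. x - r \<in> maxid"
    if P: "degree P = n" "lead_coeff P = 1" "\<And>i. v (coeff P i) \<le> 1" and x: "x \<in> V" "poly (map_poly \<iota> P) x = 0"
    for P x
  proof -
    have "\<forall>i. \<exists>s. s \<in> S \<and> v (coeff P i - s) < 1" using S(2)[OF P(3)] by blast
    then obtain s where s: "\<forall>i. s i \<in> S \<and> v (coeff P i - s i) < 1" by (rule choice[THEN exE])
    define xs where "xs = map s [0..<n]"
    have len: "length xs = n" by (simp add: xs_def)
    have "xs \<in> L" using s by (auto simp: L_def xs_def)
    have close: "v (coeff (Q xs - P) i) < 1" for i
    proof -
      consider "i < n" | "i = n" | "i > n" by linarith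
      then show ?thesis
      proof cases
        case 1
        then have "xs ! i = s i" by (simp add: xs_def)
        then have "coeff (Q xs - P) i = s i - coeff P i" using 1 by (simp add: Q[OF len])
        then show ?thesis using s abs_minus_commute[of "s i" "coeff P i"] by simp
      qed (use P(1,2) in \<open>auto simp: Q[OF len] coeff_eq_0\<close>)
    qed
    have "poly (map_poly \<iota> (Q xs - P)) x = (\<Sum>i\<le>degree (Q xs - P). \<iota> (coeff (Q xs - P) i) * x ^ i)"
      unfolding poly_altdef by (simp add: degree_map_poly coeff_map_poly hom_eq_0_iff)
    also have "\<dots> \<in> maxid"
    proof (rule maxid_sum)
      fix i
      show "\<iota> (coeff (Q xs - P) i) * x ^ i \<in> maxid"
        using maxid_mult[OF V_power[OF x(1)], of "\<iota> (coeff (Q xs - P) i)" i] close[of i]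
        by (simp only: hom_in_maxid_iff mult.commute)
    qed
    also have "map_poly \<iota> (Q xs - P) = map_poly \<iota> (Q xs) - map_poly \<iota> P"
      by (rule poly_eqI) (simp add: coeff_map_poly hom_minus)
    finally have small: "poly (map_poly \<iota> (Q xs)) x \<in> maxid" using x(2) by simp
    have "map_poly \<iota> (Q xs) \<noteq> 0" using monic(2)[OF len] by auto
    then obtain T where T: "map_poly \<iota> (Q xs) = smult (lead_coeff (map_poly \<iota> (Q xs))) (\<Prod>t\<in>#T. [:- t, 1:])"
      using alg_closed_imp_factorization[of "map_poly \<iota> (Q xs)"] by blast
    then have T: "map_poly \<iota> (Q xs) = (\<Prod>t\<in>#T. [:- t, 1:])"
      by (simp only: monic(2)[OF len] smult_1_left)
    have "\<exists>t\<in>#T. x - t \<in> maxid" if "poly (\<Prod>t\<in>#T. [:- t, 1:]) x \<in> maxid" for T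
      using that
    proof (induction T)
      case empty
      then show ?case using one_notin_maxid by simp
    next
      case (add t T)
      then have "(x - t) * poly (\<Prod>t\<in>#T. [:- t, 1:]) x \<in> maxid" by (simp add: algebra_simps)
      then show ?case using maxid_prime add.IH by auto
    qed
    then obtain t where t: "t \<in># T" "x - t \<in> maxid" using small unfolding T by blast
    then have "poly (map_poly \<iota> (Q xs)) t = 0" by (auto simp: T poly_prod_mset prod_mset_zero_iff)
    then have "t \<in> R" unfolding R_def using \<open>xs \<in> L\<close> by blast
    then show ?thesis using t(2) by blast
  qed
  ultimately show ?thesis by (intro result) blast+
qed

lemma power_minus_1_in_maxid:
  assumes "x \<in> V" "x - 1 \<in> maxid"
  shows "x ^ k - 1 \<in> maxid"
proof (induction k)
  case (Suc k)
  have "x ^ Suc k - 1 = x ^ k * (x - 1) + (x ^ k - 1)" by (simp add: algebra_simps)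
  also have "\<dots> \<in> maxid"
    by (rule maxid_add[OF maxid_mult[OF V_power[OF assms(1)] assms(2)] Suc])
  finally show ?case .
qed (simp add: zero_in_maxid)

text \<open>The powers of an eigenvalue \<open>e\<close> of \<open>A\<close> are eigenvalues of powers of \<open>A\<close>, so they are all
  roots of integral polynomials of the same degree \<open>n\<close> and fall into finitely many residue classes, whose
  number \<open>|R|\<close> does not depend on \<open>A\<close>. Two of the first \<open>|R| + 1\<close> powers are congruent,
  so \<open>e^d\<close> is congruent to \<open>1\<close> for some \<open>d \<le> |R|\<close>, and \<open>d\<close> divides \<open>|R|!\<close>.\<close>
lemma residue_exponent:
  obtains M :: nat where "M > 0"
    "\<forall>A \<in> carrier_mat n n. (\<forall>e\<in>eigs A. val_unit e) \<longrightarrow> (\<forall>e\<in>eigs A. e ^ M - 1 \<in> maxid)"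
proof -
  note result = that
  obtain R :: "'k set" where R: "finite R" "\<forall>P x. degree P = n \<and> lead_coeff P = 1 \<and>
      (\<forall>i. v (coeff P i) \<le> 1) \<and> x \<in> V \<and> poly (map_poly \<iota> P) x = 0 \<longrightarrow> (\<exists>r\<in>R. x - r \<in> maxid)"
    by (rule finite_residues_of_roots[where n = n])
  have "e ^ fact (card R) - 1 \<in> maxid"
    if A: "A \<in> carrier_mat n n" and unit: "\<And>e. e \<in> eigs A \<Longrightarrow> val_unit e" and e: "e \<in> eigs A" for A e
  proof -
    have eV: "e \<in> V" using unit[OF e] by (simp add: val_unit_def)
    have "\<exists>r. r \<in> R \<and> e ^ Suc i - r \<in> maxid" for i
    proof -
      have Ai: "A ^\<^sub>m Suc i \<in> carrier_mat n n" using A by (rule pow_carrier_mat)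
      have eigs: "eigs (A ^\<^sub>m Suc i) = (\<lambda>e. e ^ Suc i) ` eigs A" using A by (rule eigs_pow) simp
      then have "eigs (A ^\<^sub>m Suc i) \<subseteq> V" using unit V_power by (auto simp: val_unit_def simp del: power_Suc)
      then have integral: "v (coeff (char_poly (A ^\<^sub>m Suc i)) j) \<le> 1" for j
        by (rule char_poly_integral[OF Ai])
      have "e ^ Suc i \<in> eigs (A ^\<^sub>m Suc i)" unfolding eigs using e by (rule imageI)
      then have root: "poly (map_poly \<iota> (char_poly (A ^\<^sub>m Suc i))) (e ^ Suc i) = 0"
        unfolding eigs_def by (rule CollectD)
      have "degree (char_poly (A ^\<^sub>m Suc i)) = n" "lead_coeff (char_poly (A ^\<^sub>m Suc i)) = 1"
        using degree_monic_char_poly[OF Ai] by blast+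
      with R(2) integral V_power[OF eV] root show ?thesis by blast
    qed
    then have "\<forall>i. \<exists>r. r \<in> R \<and> e ^ Suc i - r \<in> maxid" by blast
    then obtain r where r: "\<forall>i. r i \<in> R \<and> e ^ Suc i - r i \<in> maxid" by (rule choice[THEN exE])
    have "\<not> inj_on r {..card R}"
    proof
      assume "inj_on r {..card R}"
      then have "card {..card R} \<le> card R" using r R(1) by (intro card_inj_on_le[of r]) auto
      then show False by simp
    qed
    then obtain a b where ab: "a \<le> card R" "b \<le> card R" "r a = r b" "a \<noteq> b"
      unfolding inj_on_def by blast
    define i j where "i = min a b" and "j = max a b"
    have ij: "i \<le> card R" "j \<le> card R" "r i = r j" "i < j"
      using ab by (auto simp: i_def j_def min_def max_def)
    have "(e ^ Suc j - r j) - (e ^ Suc i - r i) \<in> maxid" by (rule maxid_diff) (use r in blast)+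
    also have "(e ^ Suc j - r j) - (e ^ Suc i - r i) = e ^ Suc i * (e ^ (j - i) - 1)"
      using ij by (simp add: algebra_simps power_add[symmetric])
    finally have "e ^ (j - i) - 1 \<in> maxid"
      using maxid_prime val_unit_power[OF unit[OF e], of "Suc i"] by (auto simp: val_unit_iff)
    moreover have "j - i dvd fact (card R)" using ij by (intro dvd_fact) auto
    then obtain k where "fact (card R) = (j - i) * k" by (rule dvdE)
    ultimately show ?thesis
      using power_minus_1_in_maxid[OF V_power[OF eV], of "j - i" k] by (simp add: power_mult)
  qed
  then show ?thesis by (intro result[OF fact_gt_zero]) blast
qed

section \<open>Matrices with roots of exponent \<open>q^k\<close> for all \<open>k\<close>\<close>

lemma eigs_root:
  assumes A: "A \<in> carrier_mat n n" and e: "e \<in> eigs A"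
  shows "char_poly A \<noteq> 0" "degree (char_poly A) \<le> n" "poly (map_poly \<iota> (char_poly A)) e = 0"
  using degree_monic_char_poly[OF A] e by (auto simp: eigs_def)

lemma zero_notin_eigs:
  assumes A: "A \<in> carrier_mat n n" and det: "det A \<noteq> 0"
  shows "0 \<notin> eigs A"
proof -
  have "A + 0 \<cdot>\<^sub>m 1\<^sub>m n = A" using A by auto
  then have "poly (char_poly A) 0 \<noteq> 0"
    using char_poly_root_iff[OF A, of 0] det by (simp add: poly_mat_linear[OF A])
  then have "\<iota> (poly (char_poly A) 0) \<noteq> 0" by (simp only: hom_eq_0_iff not_False_eq_True)
  then have "coeff (map_poly \<iota> (char_poly A)) 0 \<noteq> 0"
    by (simp add: coeff_map_poly poly_0_coeff_0)
  then show ?thesis by (simp add: eigs_def poly_0_coeff_0)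
qed

context
  fixes g :: "'f mat" and n q :: nat and x :: "nat \<Rightarrow> 'f mat"
  assumes g: "g \<in> carrier_mat n n" "det g \<noteq> 0"
    and q: "prime q"
    and x: "\<And>k. x k \<in> carrier_mat n n" "\<And>k. x k ^\<^sub>m (q ^ k) = g"
begin

lemma q_power_pos: "0 < q ^ k"
  using prime_gt_0_nat[OF q] by simp

lemma eigs_g: "eigs g = (\<lambda>e. e ^ (q ^ k)) ` eigs (x k)"
  using eigs_pow[OF x(1) q_power_pos, of k k] by (simp only: x(2))

text \<open>The power \<open>e^(q^k)\<close> is an eigenvalue of \<open>g\<close>, and each eigenvalue of \<open>g\<close> is a \<open>q^l\<close>-th
  power of an eigenvalue of \<open>x\<^sub>l\<close>, for every \<open>l\<close>.\<close>
lemma eigs_roots_unit: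
  assumes e: "e \<in> eigs (x k)"
  shows "val_unit e"
proof (rule val_unit_if_power)
  have "e ^ (q ^ k) \<in> eigs g" unfolding eigs_g[of k] using e by (rule imageI)
  then show "val_unit (e ^ (q ^ k))"
  proof (intro val_unit_if_infinitely_divisible[where d = n, OF prime_ge_2_nat[OF q]])
    show "e ^ (q ^ k) \<noteq> 0" using \<open>e ^ (q ^ k) \<in> eigs g\<close> zero_notin_eigs[OF g] by metis
    fix l
    from \<open>e ^ (q ^ k) \<in> eigs g\<close> obtain y where y: "y \<in> eigs (x l)" "e ^ (q ^ k) = y ^ (q ^ l)"
      unfolding eigs_g[of l] by blast
    show "\<exists>y P. y ^ (q ^ l) = e ^ (q ^ k) \<and> P \<noteq> 0 \<and> degree P \<le> n \<and> poly (map_poly \<iota> P) y = 0"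
      using eigs_root[OF x(1) y(1)] y(2) by (intro exI[of _ y] exI[of _ "char_poly (x l)"]) simp
  qed
qed (rule q_power_pos)

lemma eigs_g_unit: "e \<in> eigs g \<Longrightarrow> val_unit e"
  using eigs_roots_unit[of _ 0] eigs_g[of 0] by auto

lemma prime_to_q_exponent:
  obtains M a where "M > 0" "coprime M q" "\<forall>k. \<forall>e\<in>eigs (x k). e ^ (q ^ a * M) - 1 \<in> maxid"
proof -
  note result = that
  obtain M0 :: nat where M0: "M0 > 0"
    "\<forall>A \<in> carrier_mat n n. (\<forall>e\<in>eigs A. val_unit e) \<longrightarrow> (\<forall>e\<in>eigs A. e ^ M0 - 1 \<in> maxid)"
    by (rule residue_exponent[where n = n])
  have "M0 \<noteq> 0" "\<not> is_unit q" using M0(1) not_prime_unit[of q] q by auto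
  then obtain M where M: "M0 = q ^ multiplicity q M0 * M" "\<not> q dvd M"
    by (rule multiplicity_decompose')
  have "M > 0" using M(1) M0(1) by (cases M) auto
  moreover have "coprime M q" using prime_imp_coprime[OF q M(2)] by (simp add: coprime_commute)
  moreover have "e ^ (q ^ multiplicity q M0 * M) - 1 \<in> maxid" if "e \<in> eigs (x k)" for k e
  proof -
    have "e ^ M0 - 1 \<in> maxid" using M0(2) x(1) eigs_roots_unit that by blast
    then show ?thesis by (simp only: M(1)[symmetric])
  qed
  ultimately show ?thesis by (intro result[of M "multiplicity q M0"]) blast+
qed

lemma diff_1_power:
  fixes y :: 'k
  assumes "P = CHAR('f) ^ k"
  shows "(y - 1) ^ P = y ^ P - 1"
  using CHAR_prime assms by (intro freshmans_dream_diff_1[of _ k]) (simp_all add: CHAR_extension)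

text \<open>Since \<open>e^M - 1\<close> has \<open>p^a\<close>-th power \<open>e^(p^a M) - 1\<close>, the exponent \<open>M\<close> alone brings the
  eigenvalues \<open>e\<close> of every \<open>x\<^sub>k\<close> close to \<open>1\<close>. An eigenvalue \<open>c\<close> of \<open>g^M - 1\<close> is then the
  \<open>p^k\<close>-th power of an eigenvalue of \<open>x\<^sub>k^M - 1\<close> for all \<open>k\<close>; it is in the maximal ideal, and it would be
  a unit if it were not zero. So all \<open>x\<^sub>k^M - 1\<close> are nilpotent.\<close>
lemma finite_order_if_q_eq_CHAR:
  assumes qp: "q = CHAR('f)"
  obtains M where "M > 0" "coprime M q" "g ^\<^sub>m M = 1\<^sub>m n"
proof -
  obtain M a where M: "M > 0" "coprime M q" "\<forall>k. \<forall>e\<in>eigs (x k). e ^ (q ^ a * M) - 1 \<in> maxid"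
    by (rule prime_to_q_exponent)
  have small: "e ^ M - 1 \<in> maxid" if "e \<in> eigs (x k)" for e k
  proof -
    have "(e ^ M - 1) ^ (q ^ a) = e ^ (q ^ a * M) - 1"
      using diff_1_power[of "q ^ a" a "e ^ M"] by (simp add: qp power_mult[symmetric] mult.commute)
    then have "(e ^ M - 1) ^ (q ^ a) \<in> maxid" using M(3) that by simp
    then show ?thesis by (simp only: maxid_power_iff[OF q_power_pos])
  qed
  let ?N = "\<lambda>k. x k ^\<^sub>m M - 1\<^sub>m n"
  have N: "?N k \<in> carrier_mat n n" for k using x(1) by (intro minus_carrier_mat) auto
  have N_power: "?N k ^\<^sub>m (q ^ k) = g ^\<^sub>m M - 1\<^sub>m n" for k
  proof -
    have "?N k ^\<^sub>m (q ^ k) = (x k ^\<^sub>m M) ^\<^sub>m (q ^ k) - 1\<^sub>m n"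
      using x(1) by (intro freshmans_dream_mat[OF CHAR_prime, of _ k]) (auto simp: qp)
    also have "(x k ^\<^sub>m M) ^\<^sub>m (q ^ k) = g ^\<^sub>m M"
      using pow_mat_mult[OF x(1), of k M "q ^ k"] pow_mat_mult[OF x(1), of k "q ^ k" M]
      by (simp add: x(2) mult.commute)
    finally show ?thesis .
  qed
  have eigs_N: "eigs (?N k) = (\<lambda>e. e ^ M - 1) ` eigs (x k)" for k
    using x(1) M(1) by (rule eigs_pow_diff_1)
  have eigs_gM: "eigs (g ^\<^sub>m M - 1\<^sub>m n) = (\<lambda>e. e ^ (q ^ k)) ` eigs (?N k)" for k
    using eigs_pow[OF N q_power_pos, of k k] by (simp only: N_power)
  have zero: "c = 0" if c: "c \<in> eigs (g ^\<^sub>m M - 1\<^sub>m n)" for c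
  proof (rule ccontr)
    assume "c \<noteq> 0"
    have "val_unit c"
    proof (rule val_unit_if_infinitely_divisible[where d = n, OF prime_ge_2_nat[OF q] \<open>c \<noteq> 0\<close>])
      fix k
      obtain y where y: "y \<in> eigs (?N k)" "c = y ^ (q ^ k)" using c unfolding eigs_gM[of k] by blast
      show "\<exists>y P. y ^ (q ^ k) = c \<and> P \<noteq> 0 \<and> degree P \<le> n \<and> poly (map_poly \<iota> P) y = 0"
        using eigs_root[OF N y(1)] y(2) by (intro exI[of _ y] exI[of _ "char_poly (?N k)"]) simp
    qed
    \<comment> \<open>The case \<open>k = 0\<close> of the description of \<open>c\<close> as a \<open>q^k\<close>-th power.\<close>
    moreover have "c \<in> maxid"
    proof -
      obtain y where "y \<in> eigs (?N 0)" "c = y ^ (q ^ 0)" using c unfolding eigs_gM[of 0] by blast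
      then obtain e where "e \<in> eigs (x 0)" "c = e ^ M - 1" unfolding eigs_N by auto
      then show ?thesis using small by simp
    qed
    ultimately show False by (simp add: val_unit_iff)
  qed
  have "eigs (?N n) \<subseteq> {0}"
  proof
    fix y assume "y \<in> eigs (?N n)"
    then have "y ^ (q ^ n) \<in> eigs (g ^\<^sub>m M - 1\<^sub>m n)" unfolding eigs_gM[of n] by (rule imageI)
    then have "y ^ (q ^ n) = 0" by (rule zero)
    then show "y \<in> {0}" using q_power_pos by simp
  qed
  then have nil: "?N n ^\<^sub>m n = 0\<^sub>m n n" by (rule nilpotent_if_eigs_0[OF N])
  have "n < 2 ^ n" by (rule less_exp)
  also have "(2::nat) ^ n \<le> q ^ n" using prime_ge_2_nat[OF q] by (rule power_mono) simp
  finally obtain d where d: "q ^ n = n + d" by (metis less_imp_add_positive)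
  have "g ^\<^sub>m M - 1\<^sub>m n = 0\<^sub>m n n"
    using N[of n] unfolding N_power[of n, symmetric] d
    by (simp add: pow_mat_add[OF N] nil left_mult_zero_mat[of _ n n])
  then have "g ^\<^sub>m M = 1\<^sub>m n"
  proof -
    assume eq: "g ^\<^sub>m M - 1\<^sub>m n = 0\<^sub>m n n"
    have gM: "g ^\<^sub>m M \<in> carrier_mat n n" using g by simp
    show ?thesis
    proof (rule eq_matI)
      fix i j assume "i < dim_row (1\<^sub>m n :: 'f mat)" "j < dim_col (1\<^sub>m n :: 'f mat)"
      then show "(g ^\<^sub>m M) $$ (i, j) = 1\<^sub>m n $$ (i, j)"
        using arg_cong[OF eq, of "\<lambda>A. A $$ (i, j)"] gM by simp
    qed (use gM in auto)
  qed
  then show ?thesis using M(1,2) that by blast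
qed

text \<open>Every eigenvalue of \<open>g^M\<close> has the form \<open>y^(q^a M)\<close> with an eigenvalue \<open>y\<close> of \<open>x\<^sub>a\<close>, so
  \<open>g^M - 1\<close> contracts, and \<open>g^(M p^m) - 1 = (g^M - 1)^(p^m)\<close> by the Frobenius identity.
  For \<open>q \<noteq> p\<close> the exponents \<open>M p^m\<close> are prime to \<open>q\<close>.\<close>
lemma powers_tendsto_1:
  obtains M where "M > 0" "coprime M q"
    "\<And>i j. i < n \<Longrightarrow> j < n \<Longrightarrow> conv_to (\<lambda>m. (g ^\<^sub>m (M * CHAR('f) ^ m)) $$ (i, j)) (1\<^sub>m n $$ (i, j))"
proof -
  obtain M a where M: "M > 0" "coprime M q" "\<forall>k. \<forall>e\<in>eigs (x k). e ^ (q ^ a * M) - 1 \<in> maxid"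
    by (rule prime_to_q_exponent)
  let ?N = "g ^\<^sub>m M - 1\<^sub>m n"
  have gM: "g ^\<^sub>m M \<in> carrier_mat n n" using g by simp
  then have N: "?N \<in> carrier_mat n n" by (intro minus_carrier_mat) auto
  have "eigs ?N \<subseteq> maxid"
  proof
    fix c assume "c \<in> eigs ?N"
    then obtain e where e: "e \<in> eigs g" "c = e ^ M - 1"
      unfolding eigs_pow_diff_1[OF g(1) M(1)] by blast
    then obtain y where "y \<in> eigs (x a)" "e = y ^ (q ^ a)" unfolding eigs_g[of a] by blast
    then show "c \<in> maxid" using M(3) e by (simp add: power_mult)
  qed
  note null = powers_tendsto_0[OF N this]
  have "conv_to (\<lambda>m. (g ^\<^sub>m (M * CHAR('f) ^ m)) $$ (i, j)) (1\<^sub>m n $$ (i, j))" if ij: "i < n" "j < n" for i j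
  proof -
    have "(g ^\<^sub>m (M * CHAR('f) ^ m)) $$ (i, j) = (?N ^\<^sub>m (CHAR('f) ^ m)) $$ (i, j) + 1\<^sub>m n $$ (i, j)" for m
      using ij gM by (simp add: freshmans_dream_mat[OF CHAR_prime refl gM, of m] pow_mat_mult[OF g(1)])
    moreover have "strict_mono (\<lambda>m. CHAR('f) ^ m)"
      using prime_gt_1_nat[OF CHAR_prime] by (intro strict_monoI power_strict_increasing)
    then have "conv_to (\<lambda>m. (?N ^\<^sub>m (CHAR('f) ^ m)) $$ (i, j) + 1\<^sub>m n $$ (i, j)) (0 + 1\<^sub>m n $$ (i, j))"
      by (intro conv_to_add conv_to_const conv_to_subseq[OF null[OF ij]])
    ultimately show ?thesis by simp
  qed
  then show ?thesis using M(1,2) that by blast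
qed

lemma powers_of_g_bounded: "\<exists>B. \<forall>m i j. i < n \<longrightarrow> j < n \<longrightarrow> v ((g ^\<^sub>m m) $$ (i, j)) \<le> B"
  using g(1) by (rule powers_bounded) (use eigs_g_unit in \<open>auto simp: val_unit_def\<close>)

end

end

section \<open>Limits of rational matrices and the Zariski closure\<close>

lemma carrier_GL: "A \<in> carrier (GL n) \<longleftrightarrow> A \<in> carrier_mat n n \<and> det A \<noteq> 0"
proof
  assume "A \<in> carrier (GL n)"
  then have A: "A \<in> Units (ring_mat TYPE('a) n ())" by (simp add: GL_def units_of_carrier)
  then have "A \<in> carrier_mat n n" by (simp add: Units_def ring_mat_simps)
  then show "A \<in> carrier_mat n n \<and> det A \<noteq> 0" using unit_imp_det_non_zero[OF A] by simp
next
  assume "A \<in> carrier_mat n n \<and> det A \<noteq> 0"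
  then show "A \<in> carrier (GL n)"
    by (simp add: GL_def units_of_carrier det_non_zero_imp_unit)
qed

lemma one_GL: "\<one>\<^bsub>GL n\<^esub> = 1\<^sub>m n"
  by (simp add: GL_def units_of_one ring_mat_simps)

lemma mult_GL: "A \<otimes>\<^bsub>GL n\<^esub> B = A * B"
  by (simp add: GL_def units_of_mult ring_mat_simps)

lemma pow_GL:
  assumes "A \<in> carrier_mat n n"
  shows "A [^]\<^bsub>GL n\<^esub> (k::nat) = A ^\<^sub>m k"
proof -
  interpret group "GL n :: 'a mat monoid" by (rule group_GL)
  show ?thesis using assms by (induction k) (simp_all add: one_GL mult_GL)
qed

lemma pow_GL_in_generate:
  assumes "A \<in> carrier_mat n n"
  shows "A ^\<^sub>m k \<in> generate (GL n) {A}"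
proof (induction k)
  case 0
  then show ?case using assms generate.one[of "GL n" "{A}"] by (simp add: one_GL)
next
  case (Suc k)
  then show ?case using generate.eng[OF Suc generate.incl[of A "{A}" "GL n"]] by (simp add: mult_GL)
qed

lemma det_pow_mat:
  fixes A :: "'a::comm_ring_1 mat"
  assumes "A \<in> carrier_mat n n"
  shows "det (A ^\<^sub>m k) = det A ^ k"
  using assms by (induction k) (simp_all add: det_mult[of _ n])

lemma one_pow_mat: "1\<^sub>m n ^\<^sub>m k = (1\<^sub>m n :: 'a::semiring_1 mat)"
  by (induction k) simp_all

context local_abs
begin

definition conv_mat :: "nat \<Rightarrow> (nat \<Rightarrow> 'f mat) \<Rightarrow> 'f mat \<Rightarrow> bool" where
  "conv_mat n A B \<longleftrightarrow> (\<forall>i<n. \<forall>j<n. conv_to (\<lambda>k. A k $$ (i, j)) (B $$ (i, j)))"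

lemma conv_mat_const: "conv_mat n (\<lambda>k. B) B"
  by (simp add: conv_mat_def conv_to_const)

lemma conv_mat_mult:
  assumes "conv_mat n A B" "conv_mat n C D"
    and carr: "\<And>k. A k \<in> carrier_mat n n" "\<And>k. C k \<in> carrier_mat n n" "B \<in> carrier_mat n n" "D \<in> carrier_mat n n"
  shows "conv_mat n (\<lambda>k. A k * C k) (B * D)"
  unfolding conv_mat_def
proof (intro allI impI)
  fix i j assume ij: "i < n" "j < n"
  have "conv_to (\<lambda>k. \<Sum>l<n. A k $$ (i, l) * C k $$ (l, j)) (\<Sum>l<n. B $$ (i, l) * D $$ (l, j))"
    using assms(1,2) ij by (intro conv_to_sum conv_to_mult) (simp_all add: conv_mat_def)
  moreover have "(X * Y) $$ (i, j) = (\<Sum>l<n. X $$ (i, l) * Y $$ (l, j))"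
    if "X \<in> carrier_mat n n" "Y \<in> carrier_mat n n" for X Y :: "'f mat"
    using that ij by (simp add: scalar_prod_def atLeast0LessThan)
  ultimately show "conv_to (\<lambda>k. (A k * C k) $$ (i, j)) ((B * D) $$ (i, j))"
    using carr by simp
qed

lemma conv_mat_power:
  assumes conv: "conv_mat n A B" and carr: "\<And>k. A k \<in> carrier_mat n n" "B \<in> carrier_mat n n"
  shows "conv_mat n (\<lambda>k. A k ^\<^sub>m m) (B ^\<^sub>m m)"
proof (induction m)
  case 0
  have "dim_row (A k) = dim_row B" for k using carr by (metis carrier_matD(1))
  then show ?case by (simp add: conv_mat_const)
next
  case (Suc m)
  then show ?case using conv carr by (simp add: conv_mat_mult)
qed

lemma conv_mat_unique:
  assumes "conv_mat n A B" "conv_mat n A C" "B \<in> carrier_mat n n" "C \<in> carrier_mat n n"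
  shows "B = C"
proof (rule eq_matI)
  fix i j assume "i < dim_row C" "j < dim_col C"
  then have ij: "i < n" "j < n" using assms(4) by auto
  have "conv_to (\<lambda>k. A k $$ (i, j)) (B $$ (i, j))" "conv_to (\<lambda>k. A k $$ (i, j)) (C $$ (i, j))"
    using assms(1,2) ij unfolding conv_mat_def by blast+
  then show "B $$ (i, j) = C $$ (i, j)" by (rule conv_to_unique)
qed (use assms(3,4) in auto)

lemma conv_mat_subseq: "conv_mat n A B \<Longrightarrow> strict_mono r \<Longrightarrow> conv_mat n (\<lambda>k. A (r k)) B"
  unfolding conv_mat_def
proof (intro allI impI)
  fix i j assume conv: "\<forall>i<n. \<forall>j<n. conv_to (\<lambda>k. A k $$ (i, j)) (B $$ (i, j))"
    and r: "strict_mono r" and ij: "i < n" "j < n"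
  have "conv_to (\<lambda>k. A k $$ (i, j)) (B $$ (i, j))" using conv ij by blast
  then show "conv_to (\<lambda>k. A (r k) $$ (i, j)) (B $$ (i, j))"
    by (rule conv_to_subseq[of "\<lambda>k. A k $$ (i, j)", OF _ r])
qed

lemma bounded_mat_subseq:
  assumes "\<And>(k::nat) i j. i < n \<Longrightarrow> j < n \<Longrightarrow> v (A k $$ (i, j)) \<le> B"
  obtains r L where "strict_mono r" "L \<in> carrier_mat n n" "conv_mat n (\<lambda>k. A (r k)) L"
proof -
  have "\<exists>l r. strict_mono r \<and> (\<forall>ij\<in>{..<n} \<times> {..<n}. conv_to (\<lambda>k. A (r k) $$ ij) (l ij))"
    by (rule Bolzano_Weierstrass_family[where c = "\<lambda>k ij. A k $$ ij" and B = B]) (use assms in auto)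
  then obtain l r where r: "strict_mono r" "\<And>ij. ij \<in> {..<n} \<times> {..<n} \<Longrightarrow> conv_to (\<lambda>k. A (r k) $$ ij) (l ij)"
    by blast
  have "conv_mat n (\<lambda>k. A (r k)) (mat n n l)"
    using r(2) by (simp add: conv_mat_def)
  then show ?thesis using r(1) that[of r "mat n n l"] by simp
qed

end

context valuation_extension
begin

text \<open>The subspace of \<open>F^T\<close> cut out by one linear equation with coefficients in \<open>K\<close> is closed. By
  induction on \<open>T\<close>: if the coefficient \<open>f(t)\<close> is an \<open>F\<close>-combination of the others, the
  variable at \<open>t\<close> can be eliminated; otherwise every solution vanishes at \<open>t\<close>.\<close>
lemma linear_relation_closed:
  fixes f :: "'m \<Rightarrow> 'k"
  assumes "finite T" "\<And>m. m \<in> T \<Longrightarrow> conv_to (\<lambda>i. u i m) (w m)"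
    and "\<And>i. (\<Sum>m\<in>T. f m * \<iota> (u i m)) = 0"
  shows "(\<Sum>m\<in>T. f m * \<iota> (w m)) = 0"
  using assms
proof (induction T arbitrary: u w rule: finite_induct)
  case empty
  show ?case by simp
next
  case (insert t T)
  have rel: "f t * \<iota> (u i t) + (\<Sum>m\<in>T. f m * \<iota> (u i m)) = 0" for i
    using insert.prems(2)[of i] insert.hyps by simp
  show ?case
  proof (cases "\<exists>a. f t = (\<Sum>m\<in>T. f m * \<iota> (a m))")
    case True
    then obtain a where a: "f t = (\<Sum>m\<in>T. f m * \<iota> (a m))" by blast
    have subst: "(\<Sum>m\<in>T. f m * \<iota> (y m + a m * y t)) = f t * \<iota> (y t) + (\<Sum>m\<in>T. f m * \<iota> (y m))" for y
    proof -
      have "(\<Sum>m\<in>T. f m * \<iota> (y m + a m * y t)) =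
          (\<Sum>m\<in>T. f m * \<iota> (y m)) + (\<Sum>m\<in>T. f m * \<iota> (a m)) * \<iota> (y t)"
        by (simp add: hom_add hom_mult distrib_left sum.distrib sum_distrib_right mult.assoc)
      then show ?thesis by (simp add: a add.commute)
    qed
    have "(\<Sum>m\<in>T. f m * \<iota> (w m + a m * w t)) = 0"
    proof (rule insert.IH)
      show "conv_to (\<lambda>i. u i m + a m * u i t) (w m + a m * w t)" if "m \<in> T" for m
        using that by (intro conv_to_add conv_to_mult conv_to_const insert.prems(1)) auto
      show "(\<Sum>m\<in>T. f m * \<iota> (u i m + a m * u i t)) = 0" for i
        unfolding subst by (rule rel)
    qed
    then show ?thesis using insert.hyps by (simp add: subst)
  next
    case False
    have zero: "u i t = 0" for i
    proof (rule ccontr)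
      assume nz: "u i t \<noteq> 0"
      have "f t * \<iota> (u i t) = - (\<Sum>m\<in>T. f m * \<iota> (u i m))"
        using rel[of i] by (simp add: eq_neg_iff_add_eq_0)
      then have "f t = - (\<Sum>m\<in>T. f m * \<iota> (u i m)) / \<iota> (u i t)"
        using nz by (simp add: hom_eq_0_iff field_simps)
      also have "\<dots> = (\<Sum>m\<in>T. f m * \<iota> (- u i m / u i t))"
        by (simp add: sum_negf[symmetric] sum_divide_distrib hom_div hom_uminus)
      finally have "\<exists>a. f t = (\<Sum>m\<in>T. f m * \<iota> (a m))"
        by (rule exI[of _ "\<lambda>m. - u i m / u i t"])
      then show False using False by simp
    qed
    have "w t = 0"
      using conv_to_unique[OF conv_to_const[of 0]] insert.prems(1)[of t] by (simp add: zero)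
    moreover have "(\<Sum>m\<in>T. f m * \<iota> (w m)) = 0"
    proof (rule insert.IH[of u w])
      show "conv_to (\<lambda>i. u i m) (w m)" if "m \<in> T" for m using that insert.prems(1) by simp
      show "(\<Sum>m\<in>T. f m * \<iota> (u i m)) = 0" for i using rel[of i] by (simp add: zero)
    qed
    ultimately show ?thesis using insert.hyps by simp
  qed
qed

text \<open>A polynomial over \<open>K\<close> at a matrix over \<open>F\<close> is a linear expression in the values of the
  monomials, which lie in \<open>F\<close> and are continuous. No topology on \<open>K\<close> is involved.\<close>
lemma zariski_closed_limit:
  assumes Z: "zariski_closed n Z"
    and A: "\<And>k. A k \<in> carrier_mat n n" "\<And>k. map_mat \<iota> (A k) \<in> Z"
    and B: "B \<in> carrier (GL n)" and conv: "conv_mat n A B"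
  shows "map_mat \<iota> B \<in> Z"
proof -
  obtain P where P: "P \<subseteq> matrix_polys n" "Z = {A \<in> carrier (GL n). \<forall>f\<in>P. eval_at f A = 0}"
    using Z unfolding zariski_closed_def by blast
  have Bc: "B \<in> carrier_mat n n" "det B \<noteq> 0" using B by (simp_all add: carrier_GL)
  have "det (map_mat \<iota> B) = \<iota> (det B)" by (rule hom_det)
  then have "map_mat \<iota> B \<in> carrier (GL n)" using Bc by (simp add: carrier_GL hom_eq_0_iff)
  moreover have "eval_at f (map_mat \<iota> B) = 0" if f: "f \<in> P" for f
  proof -
    define mon where "mon X m = (\<Prod>ij\<in>Poly_Mapping.keys m. X $$ ij ^ Poly_Mapping.lookup m ij)"
      for X :: "'f mat" and m :: "(nat \<times> nat) \<Rightarrow>\<^sub>0 nat"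
    have keys: "Poly_Mapping.keys m \<subseteq> {..<n} \<times> {..<n}" if "m \<in> Poly_Mapping.keys f" for m
      using f P(1) that by (auto simp: matrix_polys_def)
    have eval: "eval_at f (map_mat \<iota> X) = (\<Sum>m\<in>Poly_Mapping.keys f. Poly_Mapping.lookup f m * \<iota> (mon X m))"
      if X: "X \<in> carrier_mat n n" for X
      unfolding eval_at_def mon_def hom_prod hom_power
    proof (intro sum.cong prod.cong arg_cong2[where f = "(*)"] arg_cong2[where f = "(^)"] refl)
      fix m ij assume "m \<in> Poly_Mapping.keys f" "ij \<in> Poly_Mapping.keys m"
      then have "ij \<in> {..<n} \<times> {..<n}" using keys by blast
      then show "map_mat \<iota> X $$ ij = \<iota> (X $$ ij)" using X by (cases ij) auto
    qed
    have "(\<Sum>m\<in>Poly_Mapping.keys f. Poly_Mapping.lookup f m * \<iota> (mon B m)) = 0"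
    proof (rule linear_relation_closed[where u = "\<lambda>k. mon (A k)"])
      show "conv_to (\<lambda>k. mon (A k) m) (mon B m)" if m: "m \<in> Poly_Mapping.keys f" for m
        unfolding mon_def
      proof (intro conv_to_prod conv_to_power)
        fix ij assume "ij \<in> Poly_Mapping.keys m"
        then have "ij \<in> {..<n} \<times> {..<n}" using keys[OF m] by blast
        then show "conv_to (\<lambda>k. A k $$ ij) (B $$ ij)" using conv by (cases ij) (auto simp: conv_mat_def)
      qed
      show "(\<Sum>m\<in>Poly_Mapping.keys f. Poly_Mapping.lookup f m * \<iota> (mon (A k) m)) = 0" for k
        using A(2)[of k] f by (simp add: eval[OF A(1), symmetric] P(2))
    qed simp
    then show ?thesis by (simp add: eval[OF Bc(1)])
  qed
  ultimately show ?thesis by (simp add: P(2))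
qed

lemma zariski_closure_limit:
  assumes g: "g \<in> carrier_mat n n" and y: "y \<in> carrier (GL n)"
    and conv: "conv_mat n (\<lambda>k. g ^\<^sub>m e k) y"
  shows "y \<in> rational_points \<iota> n (zariski_closure n (generate (GL n) {map_mat \<iota> g}))"
  unfolding rational_points_def zariski_closure_def
proof (intro CollectI conjI InterI y)
  fix Z assume "Z \<in> {Z. zariski_closed n Z \<and> generate (GL n) {map_mat \<iota> g} \<subseteq> Z}"
  then have Z: "zariski_closed n Z" "generate (GL n) {map_mat \<iota> g} \<subseteq> Z" by auto
  show "map_mat \<iota> y \<in> Z"
  proof (rule zariski_closed_limit[OF Z(1) _ _ y conv])
    show "g ^\<^sub>m e k \<in> carrier_mat n n" for k using g by simp
    have "map_mat \<iota> (g ^\<^sub>m e k) \<in> generate (GL n) {map_mat \<iota> g}" for k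
      using pow_GL_in_generate[of "map_mat \<iota> g" n] g by (simp add: mat_hom_pow[OF g])
    then show "map_mat \<iota> (g ^\<^sub>m e k) \<in> Z" for k using Z(2) by blast
  qed
qed

end

section \<open>Roots in the closure and orders prime to \<open>q\<close>\<close>

text \<open>With \<open>Q a = 1 + M b\<close> and \<open>\<phi>\<close> the Euler totient of \<open>Q\<close>, the powers of \<open>p^\<phi>\<close> are congruent to
  \<open>1\<close> modulo \<open>Q\<close>, so \<open>Q\<close> divides \<open>1 + M p^(\<phi> i) b\<close> for all \<open>i\<close>.\<close>
lemma root_exponents:
  fixes p Q M :: nat
  assumes "coprime p Q" "coprime M Q" "Q > 0"
  obtains \<phi> b e where "\<phi> > 0" "\<And>i. e i * Q = 1 + M * p ^ (\<phi> * i) * b"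
proof -
  obtain a b where ab: "Q * a = M * b + 1"
    using bezout_nat[of Q M] assms by (auto simp: coprime_iff_gcd_eq_1 gcd.commute)
  define \<phi> where "\<phi> = totient Q"
  have "Q dvd 1 + M * p ^ (\<phi> * i) * b" for i
  proof -
    have "[(p ^ \<phi>) ^ i = 1 ^ i] (mod Q)" unfolding \<phi>_def using assms by (intro cong_pow euler_theorem)
    then have "[1 + M * p ^ (\<phi> * i) * b = 1 + M * 1 * b] (mod Q)"
      by (intro cong_add cong_mult cong_refl) (simp add: power_mult)
    moreover have "1 + M * 1 * b = Q * a" using ab by simp
    ultimately have "[1 + M * p ^ (\<phi> * i) * b = Q * a] (mod Q)" by simp
    then show ?thesis using cong_dvd_iff[of _ "Q * a" Q] by simp
  qed
  then have "\<forall>i. \<exists>c. 1 + M * p ^ (\<phi> * i) * b = c * Q"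
    unfolding dvd_def mult.commute[of Q] by blast
  then obtain e where "\<forall>i. 1 + M * p ^ (\<phi> * i) * b = e i * Q" by (rule choice[THEN exE])
  moreover have "\<phi> > 0" using assms by (simp add: \<phi>_def)
  ultimately show ?thesis using that[of \<phi> e b] by simp
qed

context closed_valuation_extension
begin

context
  fixes g :: "'f mat" and n q :: nat and x :: "nat \<Rightarrow> 'f mat"
  assumes g: "g \<in> carrier_mat n n" "det g \<noteq> 0"
    and q: "prime q"
    and x: "\<And>k. x k \<in> carrier_mat n n" "\<And>k. x k ^\<^sub>m (q ^ k) = g"
begin

text \<open>For \<open>q \<noteq> p\<close> the sequence \<open>g^(M p^m)\<close> takes finitely many values and tends to \<open>1\<close>, hence a
  value that is taken infinitely often is \<open>1\<close>.\<close>
lemma coprime_order: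
  assumes fin: "finite (range (\<lambda>k. g ^\<^sub>m k))"
  shows "\<exists>M>0. coprime M q \<and> g ^\<^sub>m M = 1\<^sub>m n"
proof (cases "q = CHAR('f)")
  case True
  then show ?thesis using finite_order_if_q_eq_CHAR[OF g q x] by metis
next
  case False
  obtain M where M: "M > 0" "coprime M q"
    "\<And>i j. i < n \<Longrightarrow> j < n \<Longrightarrow> conv_to (\<lambda>m. (g ^\<^sub>m (M * CHAR('f) ^ m)) $$ (i, j)) (1\<^sub>m n $$ (i, j))"
    by (rule powers_tendsto_1[OF g q x]) blast
  let ?h = "\<lambda>m. g ^\<^sub>m (M * CHAR('f) ^ m)"
  have "finite (?h ` UNIV)" by (rule finite_subset[OF _ fin]) blast
  then obtain m where inf: "infinite {a \<in> UNIV. ?h a = ?h m}"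
    using pigeonhole_infinite[of "UNIV :: nat set" ?h] by auto
  have "?h m = 1\<^sub>m n"
  proof (rule eq_matI)
    fix i j assume "i < dim_row (1\<^sub>m n :: 'f mat)" "j < dim_col (1\<^sub>m n :: 'f mat)"
    then have ij: "i < n" "j < n" by auto
    have "v (?h m $$ (i, j) - 1\<^sub>m n $$ (i, j)) < \<epsilon>" if pos: "\<epsilon> > 0" for \<epsilon>
    proof -
      obtain N where N: "\<forall>a\<ge>N. v (?h a $$ (i, j) - 1\<^sub>m n $$ (i, j)) < \<epsilon>"
        using conv_to_eventually_close[OF M(3)[OF ij] pos] by blast
      obtain a where "a \<ge> N" "?h a = ?h m"
        using inf unfolding infinite_nat_iff_unbounded_le by blast
      then show ?thesis using N[rule_format, of a] by simp
    qed
    from this[of "v (?h m $$ (i, j) - 1\<^sub>m n $$ (i, j))"]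
    show "?h m $$ (i, j) = 1\<^sub>m n $$ (i, j)" by auto
  qed (use g in auto)
  moreover have "coprime (CHAR('f)) q" using CHAR_prime q False by (simp add: primes_coprime)
  ultimately show ?thesis
    using M(1,2) CHAR_pos by (intro exI[of _ "M * CHAR('f) ^ m"]) simp
qed

text \<open>A limit \<open>y\<close> of powers \<open>g^(e\<^sub>m)\<close> is a \<open>q^k\<close>-th root of \<open>g\<close> if \<open>g^(e\<^sub>m q^k)\<close> tends to
  \<open>g\<close>. If \<open>q = p\<close>, a constant exponent does this. Otherwise
  \<open>g^(e\<^sub>m q^k) = g (g^(M p^(\<phi> m)))^b\<close> tends to \<open>g\<close>.\<close>
lemma root_in_zariski_closure:
  "\<exists>y \<in> rational_points \<iota> n (zariski_closure n (generate (GL n) {map_mat \<iota> g})). y ^\<^sub>m (q ^ k) = g"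
proof -
  have *: ?thesis
    if bounded: "\<And>m i j. i < n \<Longrightarrow> j < n \<Longrightarrow> v ((g ^\<^sub>m e m) $$ (i, j)) \<le> B"
      and conv: "conv_mat n (\<lambda>m. g ^\<^sub>m (e m * q ^ k)) g" for e B
  proof -
    obtain r y where r: "strict_mono r" and y: "y \<in> carrier_mat n n" "conv_mat n (\<lambda>m. g ^\<^sub>m e (r m)) y"
      by (rule bounded_mat_subseq[where A = "\<lambda>m. g ^\<^sub>m e m", OF bounded])
    have "conv_mat n (\<lambda>m. (g ^\<^sub>m e (r m)) ^\<^sub>m (q ^ k)) (y ^\<^sub>m (q ^ k))"
      using y g by (intro conv_mat_power) simp_all
    moreover have "conv_mat n (\<lambda>m. (g ^\<^sub>m e (r m)) ^\<^sub>m (q ^ k)) g"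
      using conv_mat_subseq[OF conv r] by (simp add: pow_mat_mult[OF g(1)])
    ultimately have yg: "y ^\<^sub>m (q ^ k) = g"
      by (rule conv_mat_unique) (use y g in simp_all)
    have "det y ^ (q ^ k) = det g" using det_pow_mat[OF y(1), of "q ^ k"] yg by simp
    then have "det y \<noteq> 0" using g(2) prime_gt_0_nat[OF q] by (auto simp: power_0_left)
    then have "y \<in> carrier (GL n)" using y(1) by (simp add: carrier_GL)
    then show ?thesis using zariski_closure_limit[OF g(1) _ y(2)] yg by blast
  qed
  obtain B where B: "\<And>m i j. i < n \<Longrightarrow> j < n \<Longrightarrow> v ((g ^\<^sub>m m) $$ (i, j)) \<le> B"
    using powers_of_g_bounded[OF g q x] by blast
  have qk: "q ^ k > 0" using prime_gt_0_nat[OF q] by simp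
  show ?thesis
  proof (cases "q = CHAR('f)")
    case True
    obtain M where M: "M > 0" "coprime M q" "g ^\<^sub>m M = 1\<^sub>m n"
      by (rule finite_order_if_q_eq_CHAR[OF g q x True])
    obtain a b where ab: "q ^ k * a = M * b + 1"
      using bezout_nat[of "q ^ k" M] M(2) qk by (auto simp: coprime_iff_gcd_eq_1[symmetric] gcd.commute)
    have "g ^\<^sub>m (a * q ^ k) = (g ^\<^sub>m M) ^\<^sub>m b * g"
      using ab pow_mat_add[OF g(1), of "M * b" 1] g(1) by (simp add: mult.commute pow_mat_mult[OF g(1)])
    also have "(g ^\<^sub>m M) ^\<^sub>m b = 1\<^sub>m n"
      unfolding M(3) by (rule one_pow_mat)
    finally have "g ^\<^sub>m (a * q ^ k) = g" using g(1) by simp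
    then show ?thesis using *[of "\<lambda>_. a" B] B by (simp add: conv_mat_const)
  next
    case False
    obtain M where M: "M > 0" "coprime M q"
      "\<And>i j. i < n \<Longrightarrow> j < n \<Longrightarrow> conv_to (\<lambda>m. (g ^\<^sub>m (M * CHAR('f) ^ m)) $$ (i, j)) (1\<^sub>m n $$ (i, j))"
      by (rule powers_tendsto_1[OF g q x]) blast
    have "coprime (CHAR('f)) (q ^ k)" using CHAR_prime q False by (simp add: primes_coprime)
    moreover have "coprime M (q ^ k)" using M(2) by simp
    ultimately obtain \<phi> b e where e: "\<phi> > 0" "\<And>i. e i * q ^ k = 1 + M * CHAR('f) ^ (\<phi> * i) * b"
      using qk by (rule root_exponents) blast
    let ?h = "\<lambda>i. g ^\<^sub>m (M * CHAR('f) ^ (\<phi> * i))"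
    have "conv_mat n (\<lambda>i. g ^\<^sub>m (M * CHAR('f) ^ i)) (1\<^sub>m n)"
      using M(3) by (simp add: conv_mat_def)
    moreover have "strict_mono (\<lambda>i. \<phi> * i)" using e(1) by (simp add: strict_mono_def)
    ultimately have "conv_mat n ?h (1\<^sub>m n)" by (rule conv_mat_subseq)
    then have "conv_mat n (\<lambda>i. ?h i ^\<^sub>m b) (1\<^sub>m n ^\<^sub>m b)"
      using g by (intro conv_mat_power) simp_all
    then have "conv_mat n (\<lambda>i. g * ?h i ^\<^sub>m b) (g * 1\<^sub>m n ^\<^sub>m b)"
      using g by (intro conv_mat_mult conv_mat_const) simp_all
    moreover have "g * 1\<^sub>m n ^\<^sub>m b = g"
      using g by (simp add: one_pow_mat)
    moreover have "g * ?h i ^\<^sub>m b = g ^\<^sub>m (e i * q ^ k)" for i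
      unfolding e(2) using pow_mat_add[OF g(1), of 1 "M * CHAR('f) ^ (\<phi> * i) * b"] g(1)
      by (simp add: pow_mat_mult[OF g(1), of "M * CHAR('f) ^ (\<phi> * i)" b])
    ultimately have "conv_mat n (\<lambda>i. g ^\<^sub>m (e i * q ^ k)) g" by simp
    then show ?thesis by (intro *[of e B] B)
  qed
qed

end

end

theorem theorem1p3:
  fixes \<iota> :: "'f::field \<Rightarrow> 'k::alg_closed_field"
    and G H :: "('k mat) set" and g :: "'f mat" and n p q :: nat
  assumes "local_field TYPE('f)" and "CHAR('f) = p" and "p > 0"
    and "field_hom \<iota>"
    and "linear_algebraic_group \<iota> n G"
    and "g \<in> rational_points \<iota> n G"
    and "prime q"
    and "\<forall>k::nat. \<exists>x \<in> rational_points \<iota> n G. x [^]\<^bsub>GL n\<^esub> (q ^ k) = g"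
    and "H = zariski_closure n (generate (GL n) {map_mat \<iota> g})"
  shows "(\<forall>k::nat. \<exists>y \<in> rational_points \<iota> n H. y [^]\<^bsub>GL n\<^esub> (q ^ k) = g) \<and>
    (finite (generate (GL n) {g}) \<longrightarrow> coprime (group.ord (GL n) g) q) \<and>
    ((\<forall>k::nat. k \<ge> 1 \<longrightarrow> (\<exists>h \<in> rational_points \<iota> n G. h [^]\<^bsub>GL n\<^esub> k = g)) \<longrightarrow>
       g = \<one>\<^bsub>GL n\<^esub>)"
proof -
  interpret GL: group "GL n :: 'f mat monoid" by (rule group_GL)
  have rational: "A \<in> carrier_mat n n" if "A \<in> rational_points \<iota> n Z" for A Z
    using that by (simp add: rational_points_def carrier_GL)
  have gG: "g \<in> carrier (GL n)" using assms(6) by (simp add: rational_points_def)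
  then have g: "g \<in> carrier_mat n n" "det g \<noteq> 0" by (simp_all add: carrier_GL)
  obtain v :: "'f \<Rightarrow> real" where v: "local_abs v"
    using local_field_imp_local_abs[OF assms(1)] assms(2,3) by blast
  obtain V where V: "valuation_extension v \<iota> V"
    using valuation_extension_exists[OF v assms(4)] by blast
  interpret valuation_extension v \<iota> V by (rule V)
  interpret closed_valuation_extension v \<iota> V
    by unfold_locales (use assms(2,3) in simp)
  have choose_roots: "\<exists>x. \<forall>k. x k \<in> carrier_mat n n \<and> x k ^\<^sub>m (r ^ k) = g"
    if roots: "\<forall>k::nat. \<exists>x \<in> rational_points \<iota> n G. x [^]\<^bsub>GL n\<^esub> (r ^ k) = g" for r :: nat
  proof (rule choice, rule allI)
    fix k
    obtain x where x: "x \<in> rational_points \<iota> n G" "x [^]\<^bsub>GL n\<^esub> (r ^ k) = g" using roots by blast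
    then show "\<exists>x. x \<in> carrier_mat n n \<and> x ^\<^sub>m (r ^ k) = g"
      using rational[OF x(1)] by (auto simp: pow_GL)
  qed
  have ord_dvd: "GL.ord g dvd M" if "g ^\<^sub>m M = 1\<^sub>m n" for M
    using that GL.pow_eq_id[OF gG, of M] by (simp add: pow_GL[OF g(1)] one_GL)
  have ord_coprime: "coprime (GL.ord g) r"
    if r: "prime r" and fin: "finite (range (\<lambda>k. g ^\<^sub>m k))"
      and roots: "\<forall>k::nat. \<exists>x \<in> rational_points \<iota> n G. x [^]\<^bsub>GL n\<^esub> (r ^ k) = g" for r
  proof -
    obtain x where x: "\<forall>k. x k \<in> carrier_mat n n \<and> x k ^\<^sub>m (r ^ k) = g"
      using choose_roots[OF roots] by blast
    have x1: "x k \<in> carrier_mat n n" and x2: "x k ^\<^sub>m (r ^ k) = g" for k using x by blast+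
    obtain M where M: "coprime M r" "g ^\<^sub>m M = 1\<^sub>m n"
      using coprime_order[OF g r x1 x2 fin] by blast
    show ?thesis using ord_dvd[OF M(2)] M(1) by (rule coprime_divisors[OF _ dvd_refl])
  qed
  obtain x where x: "\<forall>k. x k \<in> carrier_mat n n \<and> x k ^\<^sub>m (q ^ k) = g"
    using choose_roots[OF assms(8)] by blast
  have x1: "x k \<in> carrier_mat n n" and x2: "x k ^\<^sub>m (q ^ k) = g" for k using x by blast+
  show ?thesis
  proof (intro conjI impI allI)
    fix k
    obtain y where y: "y \<in> rational_points \<iota> n H" "y ^\<^sub>m (q ^ k) = g"
      using root_in_zariski_closure[OF g assms(7) x1 x2, of k] assms(9) by blast
    then show "\<exists>y \<in> rational_points \<iota> n H. y [^]\<^bsub>GL n\<^esub> (q ^ k) = g"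
      using pow_GL[OF rational[OF y(1)]] by (intro bexI[OF _ y(1)]) simp
  next
    assume "finite (generate (GL n) {g})"
    then have "finite (range (\<lambda>k. g ^\<^sub>m k))"
      by (rule finite_subset[rotated]) (use pow_GL_in_generate[OF g(1)] in blast)
    then show "coprime (GL.ord g) q" using ord_coprime assms(7,8) by blast
  next
    assume roots: "\<forall>k::nat. k \<ge> 1 \<longrightarrow> (\<exists>h \<in> rational_points \<iota> n G. h [^]\<^bsub>GL n\<^esub> k = g)"
    have roots_r: "\<forall>k::nat. \<exists>x \<in> rational_points \<iota> n G. x [^]\<^bsub>GL n\<^esub> (r ^ k) = g" if "prime r" for r :: nat
      using roots prime_gt_0_nat[OF that] by simp
    obtain z where z: "\<forall>k. z k \<in> carrier_mat n n \<and> z k ^\<^sub>m (CHAR('f) ^ k) = g"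
      using choose_roots[OF roots_r[OF CHAR_prime]] by blast
    have z1: "z k \<in> carrier_mat n n" and z2: "z k ^\<^sub>m (CHAR('f) ^ k) = g" for k using z by blast+
    obtain M where M: "M > 0" "coprime M CHAR('f)" "g ^\<^sub>m M = 1\<^sub>m n"
      by (rule finite_order_if_q_eq_CHAR[OF g CHAR_prime z1 z2 refl])
    have "range (\<lambda>k. g ^\<^sub>m k) \<subseteq> (\<lambda>k. g ^\<^sub>m k) ` {..<M}"
    proof
      fix A assume "A \<in> range (\<lambda>k. g ^\<^sub>m k)"
      then obtain k where A: "A = g ^\<^sub>m k" by blast
      have "g ^\<^sub>m (M * (k div M)) = 1\<^sub>m n"
        unfolding pow_mat_mult[OF g(1)] M(3) by (rule one_pow_mat)
      then have "g ^\<^sub>m (M * (k div M) + k mod M) = g ^\<^sub>m (k mod M)"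
        using g(1) by (simp only: pow_mat_add[OF g(1)]) simp
      then have "A = g ^\<^sub>m (k mod M)" by (simp add: A)
      then show "A \<in> (\<lambda>k. g ^\<^sub>m k) ` {..<M}" using M(1) by simp
    qed
    then have fin: "finite (range (\<lambda>k. g ^\<^sub>m k))" by (rule finite_subset) simp
    have "GL.ord g = 1"
    proof (rule ccontr)
      assume "GL.ord g \<noteq> 1"
      then obtain r where r: "prime r" "r dvd GL.ord g" using prime_factor_nat by blast
      then have "coprime (GL.ord g) r" using ord_coprime[OF r(1) fin roots_r[OF r(1)]] by simp
      then show False using r by (metis coprime_common_divisor dvd_refl not_prime_unit)
    qed
    then show "g = \<one>\<^bsub>GL n\<^esub>" using GL.ord_eq_1[OF gG] by simp
  qed
qed

end
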